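(* Consider the functor $\mathbf{Cat}((-)^{\mathrm{op}},\mathbf{Grp})\colon \mathbf{SLat}^{\mathrm{op}}\to\mathbf{Cat}$ sending a semilattice $L$ to the functor category $\mathbf{Cat}(L^{\mathrm{op}},\mathbf{Grp})$ and a homomorphism $f\colon L\to K$ to precomposition with $f^{\mathrm{op}}$. There is an equivalence of categories \[\int \mathbf{Cat}((-)^{\mathrm{op}},\mathbf{Grp})\;\simeq\;\mathbf{Cliff},\] where the left-hand side is the total category of the Grothendieck construction of this functor and $\mathbf{Cliff}$ is the category of Clifford monoids.
   Context: A Clifford monoid is an inverse monoid $M$ (with inverse operation $x\mapsto x^*$) whose idempotents are central; equivalently, a monoid with an involutive unary operation $(-)^*$ such that $xx^*x=x$ and $xx^*$ commutes with every element. $\mathbf{Cliff}$ is the category of Clifford monoids and monoid homomorphisms (these automatically preserve $(-)^*$). A semilattice here is a meet-semilattice with top element, i.e. a commutative idempotent monoid, regarded as a poset (hence a category) via $e\le e'$ iff $e=ee'$; $\mathbf{SLat}$ is the category of semilattices and monoid homomorphisms. $\mathbf{Grp}$ is the category of groups. $\mathbf{Cat}(L^{\mathrm{op}},\mathbf{Grp})$ is the category of functors $L^{\mathrm{op}}\to\mathbf{Grp}$ and natural transformations. For a (pseudo)functor $F\colon\mathcal{C}^{\mathrm{op}}\to\mathbf{Cat}$, the total category $\int F$ of the (contravariant) Grothendieck construction has as objects pairs $(C,X)$ with $C\in\mathcal{C}$, $X\in F(C)$, and as morphisms $(C,X)\to(D,Y)$ pairs $(f,\alpha)$ with $f\colon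 C\to D$ in $\mathcal{C}$ and $\alpha\colon X\to F(f)(Y)$ in $F(C)$. Thus here objects are pairs $(L,F)$ with $F\colon L^{\mathrm{op}}\to\mathbf{Grp}$, and morphisms $(L,F)\to(K,G)$ are pairs $(t,\alpha)$ with $t\colon L\to K$ a semilattice homomorphism and $\alpha\colon F\to G\circ t^{\mathrm{op}}$ a natural transformation. Size issues ($\mathbf{Cat}$ must contain the categories $\mathbf{Cat}(L^{\mathrm{op}},\mathbf{Grp})$) are handled in the usual way. *)

theory Defs
  imports "HOL-Algebra.Group"
begin

section \<open>Categories, functors and natural transformations\<close>

text \<open>
  Hom-sets are indexed by their source and target and need not be disjoint, so the composition of
  \<open>f : X \<rightarrow> Y\<close> and \<open>g : Y \<rightarrow> Z\<close> is written \<open>Comp C X Y Z g f\<close>, and the action of a functor on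
  arrows also takes the source and the target as arguments.
\<close>

record ('o, 'm) cat =
  Obj :: "'o set"
  Hom :: "'o \<Rightarrow> 'o \<Rightarrow> 'm set"
  Ident :: "'o \<Rightarrow> 'm"
  Comp :: "'o \<Rightarrow> 'o \<Rightarrow> 'o \<Rightarrow> 'm \<Rightarrow> 'm \<Rightarrow> 'm"

locale category =
  fixes C :: "('o, 'm) cat"
  assumes Ident_in: "X \<in> Obj C \<Longrightarrow> Ident C X \<in> Hom C X X"
    and Comp_in: "\<lbrakk>X \<in> Obj C; Y \<in> Obj C; Z \<in> Obj C; f \<in> Hom C X Y; g \<in> Hom C Y Z\<rbrakk>
      \<Longrightarrow> Comp C X Y Z g f \<in> Hom C X Z"
    and Comp_Ident: "\<lbrakk>X \<in> Obj C; Y \<in> Obj C; f \<in> Hom C X Y\<rbrakk> \<Longrightarrow> Comp C X X Y f (Ident C X) = f"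
    and Ident_Comp: "\<lbrakk>X \<in> Obj C; Y \<in> Obj C; f \<in> Hom C X Y\<rbrakk> \<Longrightarrow> Comp C X Y Y (Ident C Y) f = f"
    and Comp_assoc: "\<lbrakk>W \<in> Obj C; X \<in> Obj C; Y \<in> Obj C; Z \<in> Obj C;
        f \<in> Hom C W X; g \<in> Hom C X Y; h \<in> Hom C Y Z\<rbrakk>
      \<Longrightarrow> Comp C W Y Z h (Comp C W X Y g f) = Comp C W X Z (Comp C X Y Z h g) f"

definition op_cat :: "('o, 'm) cat \<Rightarrow> ('o, 'm) cat" where
  "op_cat C = \<lparr>Obj = Obj C, Hom = (\<lambda>X Y. Hom C Y X), Ident = Ident C,
     Comp = (\<lambda>X Y Z g f. Comp C Z Y X f g)\<rparr>"

record ('o, 'm, 'p, 'n) ftor =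
  fobj :: "'o \<Rightarrow> 'p"
  fmap :: "'o \<Rightarrow> 'o \<Rightarrow> 'm \<Rightarrow> 'n"

text \<open>
  Functors are \<open>undefined\<close> outside their domain category, so that equality of functors is the
  intended one; \<open>mk_ftor\<close> cuts arbitrary maps down accordingly.
\<close>

definition mk_ftor :: "('o, 'm) cat \<Rightarrow> ('o \<Rightarrow> 'p) \<Rightarrow> ('o \<Rightarrow> 'o \<Rightarrow> 'm \<Rightarrow> 'n) \<Rightarrow> ('o, 'm, 'p, 'n) ftor"
  where
  "mk_ftor A Fo Fm = \<lparr>fobj = restrict Fo (Obj A),
     fmap = (\<lambda>X Y f. if X \<in> Obj A \<and> Y \<in> Obj A \<and> f \<in> Hom A X Y then Fm X Y f else undefined)\<rparr>"

definition is_functor :: "('o, 'm) cat \<Rightarrow> ('p, 'n) cat \<Rightarrow> ('o, 'm, 'p, 'n) ftor \<Rightarrow> bool" where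
  "is_functor A B F \<longleftrightarrow>
     F = mk_ftor A (fobj F) (fmap F) \<and>
     (\<forall>X\<in>Obj A. fobj F X \<in> Obj B) \<and>
     (\<forall>X\<in>Obj A. \<forall>Y\<in>Obj A. \<forall>f\<in>Hom A X Y. fmap F X Y f \<in> Hom B (fobj F X) (fobj F Y)) \<and>
     (\<forall>X\<in>Obj A. fmap F X X (Ident A X) = Ident B (fobj F X)) \<and>
     (\<forall>X\<in>Obj A. \<forall>Y\<in>Obj A. \<forall>Z\<in>Obj A. \<forall>f\<in>Hom A X Y. \<forall>g\<in>Hom A Y Z.
        fmap F X Z (Comp A X Y Z g f) =
        Comp B (fobj F X) (fobj F Y) (fobj F Z) (fmap F Y Z g) (fmap F X Y f))"

definition id_ftor :: "('o, 'm) cat \<Rightarrow> ('o, 'm, 'o, 'm) ftor" where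
  "id_ftor A = mk_ftor A (\<lambda>X. X) (\<lambda>X Y f. f)"

text \<open>\<open>comp_ftor A G F\<close> is \<open>G \<circ> F\<close>, where \<open>A\<close> is the domain of \<open>F\<close>.\<close>

definition comp_ftor :: "('o, 'm) cat \<Rightarrow> ('p, 'n, 'q, 'l) ftor \<Rightarrow> ('o, 'm, 'p, 'n) ftor
    \<Rightarrow> ('o, 'm, 'q, 'l) ftor" where
  "comp_ftor A G F = mk_ftor A (\<lambda>X. fobj G (fobj F X))
     (\<lambda>X Y f. fmap G (fobj F X) (fobj F Y) (fmap F X Y f))"

text \<open>For \<open>F : A \<rightarrow> B\<close>, the same maps as a functor from \<open>op_cat A\<close> to \<open>op_cat B\<close>.\<close>

definition op_ftor :: "('o, 'm, 'p, 'n) ftor \<Rightarrow> ('o, 'm, 'p, 'n) ftor" where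
  "op_ftor F = \<lparr>fobj = fobj F, fmap = (\<lambda>X Y. fmap F Y X)\<rparr>"

definition nat_trans :: "('o, 'm) cat \<Rightarrow> ('p, 'n) cat \<Rightarrow> ('o, 'm, 'p, 'n) ftor
    \<Rightarrow> ('o, 'm, 'p, 'n) ftor \<Rightarrow> ('o \<Rightarrow> 'n) set" where
  "nat_trans A B F G = {\<alpha> \<in> extensional (Obj A).
     (\<forall>X\<in>Obj A. \<alpha> X \<in> Hom B (fobj F X) (fobj G X)) \<and>
     (\<forall>X\<in>Obj A. \<forall>Y\<in>Obj A. \<forall>f\<in>Hom A X Y.
        Comp B (fobj F X) (fobj G X) (fobj G Y) (fmap G X Y f) (\<alpha> X) =
        Comp B (fobj F X) (fobj F Y) (fobj G Y) (\<alpha> Y) (fmap F X Y f))}"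

definition is_iso :: "('o, 'm) cat \<Rightarrow> 'o \<Rightarrow> 'o \<Rightarrow> 'm \<Rightarrow> bool" where
  "is_iso C X Y f \<longleftrightarrow> f \<in> Hom C X Y \<and>
     (\<exists>g\<in>Hom C Y X. Comp C X Y X g f = Ident C X \<and> Comp C Y X Y f g = Ident C Y)"

definition nat_isos :: "('o, 'm) cat \<Rightarrow> ('p, 'n) cat \<Rightarrow> ('o, 'm, 'p, 'n) ftor
    \<Rightarrow> ('o, 'm, 'p, 'n) ftor \<Rightarrow> ('o \<Rightarrow> 'n) set" where
  "nat_isos A B F G =
     {\<alpha> \<in> nat_trans A B F G. \<forall>X\<in>Obj A. is_iso B (fobj F X) (fobj G X) (\<alpha> X)}"

definition equivalent_cats :: "('o, 'm) cat \<Rightarrow> ('p, 'n) cat \<Rightarrow> bool" where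
  "equivalent_cats C D \<longleftrightarrow> category C \<and> category D \<and>
     (\<exists>F G. is_functor C D F \<and> is_functor D C G \<and>
        nat_isos C C (id_ftor C) (comp_ftor C G F) \<noteq> {} \<and>
        nat_isos D D (comp_ftor D F G) (id_ftor D) \<noteq> {})"

definition Fun_cat :: "('o, 'm) cat \<Rightarrow> ('p, 'n) cat
    \<Rightarrow> (('o, 'm, 'p, 'n) ftor, 'o \<Rightarrow> 'n) cat" where
  "Fun_cat A B = \<lparr>Obj = {F. is_functor A B F}, Hom = nat_trans A B,
     Ident = (\<lambda>F. \<lambda>X\<in>Obj A. Ident B (fobj F X)),
     Comp = (\<lambda>F G H \<beta> \<alpha>. \<lambda>X\<in>Obj A. Comp B (fobj F X) (fobj G X) (fobj H X) (\<beta> X) (\<alpha> X))\<rparr>"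

text \<open>
  For \<open>T : A \<rightarrow> B\<close>, the functor \<open>Fun_cat B D \<rightarrow> Fun_cat A D\<close> given by precomposition with \<open>T\<close>.
\<close>

definition precomp_ftor :: "('o, 'm) cat \<Rightarrow> ('p, 'n) cat \<Rightarrow> ('q, 'l) cat \<Rightarrow> ('o, 'm, 'p, 'n) ftor
    \<Rightarrow> (('p, 'n, 'q, 'l) ftor, 'p \<Rightarrow> 'l, ('o, 'm, 'q, 'l) ftor, 'o \<Rightarrow> 'l) ftor" where
  "precomp_ftor A B D T = mk_ftor (Fun_cat B D) (\<lambda>G. comp_ftor A G T)
     (\<lambda>G H \<alpha>. \<lambda>X\<in>Obj A. \<alpha> (fobj T X))"

text \<open>
  The category of all categories whose objects and arrows are drawn from the given types: the
  types play the role of the universe bounding the size of the members of \<open>Cat\<close>.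
\<close>

definition Cat :: "(('o, 'm) cat, ('o, 'm, 'o, 'm) ftor) cat" where
  "Cat = \<lparr>Obj = {C. category C}, Hom = (\<lambda>A B. {F. is_functor A B F}), Ident = id_ftor,
     Comp = (\<lambda>A B C G F. comp_ftor A G F)\<rparr>"

text \<open>
  The total category of a functor \<open>F : op_cat C \<rightarrow> Cat\<close>. An arrow \<open>f : c \<rightarrow> d\<close> of \<open>C\<close> is an arrow
  from \<open>d\<close> to \<open>c\<close> in \<open>op_cat C\<close>, hence acts by \<open>fmap F d c f : F d \<rightarrow> F c\<close>.
\<close>

definition Grothendieck :: "('o, 'm) cat
    \<Rightarrow> ('o, 'm, ('p, 'n) cat, ('p, 'n, 'p, 'n) ftor) ftor \<Rightarrow> ('o \<times> 'p, 'm \<times> 'n) cat" where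
  "Grothendieck C F = \<lparr>
     Obj = (SIGMA c:Obj C. Obj (fobj F c)),
     Hom = (\<lambda>(c, x) (d, y). SIGMA f:Hom C c d. Hom (fobj F c) x (fobj (fmap F d c f) y)),
     Ident = (\<lambda>(c, x). (Ident C c, Ident (fobj F c) x)),
     Comp = (\<lambda>(c, x) (d, y) (e, z) (g, \<beta>) (f, \<alpha>).
       (Comp C c d e g f,
        Comp (fobj F c) x (fobj (fmap F d c f) y)
          (fobj (fmap F d c f) (fobj (fmap F e d g) z))
          (fmap (fmap F d c f) y (fobj (fmap F e d g) z) \<beta>) \<alpha>))\<rparr>"


section \<open>Semilattices, groups and Clifford monoids\<close>

locale semilattice_monoid = comm_monoid L for L (structure) +
  assumes mult_idem: "x \<in> carrier L \<Longrightarrow> x \<otimes> x = x"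

locale inverse_monoid = monoid M for M (structure) +
  assumes ex1_inverse: "x \<in> carrier M \<Longrightarrow>
    \<exists>!y. y \<in> carrier M \<and> x \<otimes> y \<otimes> x = x \<and> y \<otimes> x \<otimes> y = y"

locale clifford_monoid = inverse_monoid M for M (structure) +
  assumes idem_central:
    "\<lbrakk>e \<in> carrier M; e \<otimes> e = e; x \<in> carrier M\<rbrakk> \<Longrightarrow> e \<otimes> x = x \<otimes> e"

text \<open>
  Arrows are functions made extensional on the carrier. Preservation of the unit has to be added to
  \<^const>\<open>hom\<close>, which only asks for preservation of the multiplication.
\<close>

definition monoid_homs :: "'a monoid \<Rightarrow> 'b monoid \<Rightarrow> ('a \<Rightarrow> 'b) set" where
  "monoid_homs G H = {h \<in> hom G H \<inter> extensional (carrier G). h \<one>\<^bsub>G\<^esub> = \<one>\<^bsub>H\<^esub>}"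

lemma monoid_homs_group:
  assumes "group G" "group H"
  shows "monoid_homs G H = hom G H \<inter> extensional (carrier G)"
  using assms by (auto simp: monoid_homs_def hom_one)

text \<open>
  The category of the structures in a given class of monoids, with all monoid homomorphisms.
  The underlying sets are the subsets of the type \<open>'a\<close>, which thus bounds their size. An infinite
  \<open>'a\<close> contains a copy of \<open>'a \<times> 'a\<close>, hence of the disjoint union of a family of groups indexed by a
  semilattice; for a finite \<open>'a\<close> the disjoint union need not fit.
  Records that differ only in the values of the multiplication outside the carrier are distinct but
  isomorphic objects.
\<close>

definition Mon_cat :: "'a monoid set \<Rightarrow> ('a monoid, 'a \<Rightarrow> 'a) cat" where
  "Mon_cat \<M> = \<lparr>Obj = \<M>, Hom = monoid_homs, Ident = (\<lambda>G. \<lambda>x\<in>carrier G. x),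
     Comp = (\<lambda>G H K g f. compose (carrier G) g f)\<rparr>"

definition SLat :: "('a monoid, 'a \<Rightarrow> 'a) cat" where
  "SLat = Mon_cat {L. semilattice_monoid L}"

definition Grp :: "('a monoid, 'a \<Rightarrow> 'a) cat" where
  "Grp = Mon_cat {G. group G}"

definition Cliff :: "('a monoid, 'a \<Rightarrow> 'a) cat" where
  "Cliff = Mon_cat {M. clifford_monoid M}"

definition poset_cat :: "'a monoid \<Rightarrow> ('a, unit) cat" where
  "poset_cat L = \<lparr>Obj = carrier L, Hom = (\<lambda>e e'. {_. e = e \<otimes>\<^bsub>L\<^esub> e'}), Ident = (\<lambda>_. ()),
     Comp = (\<lambda>_ _ _ _ _. ())\<rparr>"

definition poset_ftor :: "'a monoid \<Rightarrow> ('a \<Rightarrow> 'a) \<Rightarrow> ('a, unit, 'a, unit) ftor" where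
  "poset_ftor L t = mk_ftor (poset_cat L) t (\<lambda>_ _ _. ())"

text \<open>
  The functor \<open>L \<mapsto> Cat(L\<^sup>o\<^sup>p, Grp)\<close>. An arrow \<open>K \<rightarrow> L\<close> of \<open>op_cat SLat\<close> is a homomorphism
  \<open>t : L \<rightarrow> K\<close>; it is sent to precomposition with \<open>t\<^sup>o\<^sup>p\<close>.
\<close>

definition Cat_op_Grp :: "('a monoid, 'a \<Rightarrow> 'a,
     (('a, unit, 'a monoid, 'a \<Rightarrow> 'a) ftor, 'a \<Rightarrow> 'a \<Rightarrow> 'a) cat,
     (('a, unit, 'a monoid, 'a \<Rightarrow> 'a) ftor, 'a \<Rightarrow> 'a \<Rightarrow> 'a,
      ('a, unit, 'a monoid, 'a \<Rightarrow> 'a) ftor, 'a \<Rightarrow> 'a \<Rightarrow> 'a) ftor) ftor" where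
  "Cat_op_Grp = mk_ftor (op_cat SLat)
     (\<lambda>L. Fun_cat (op_cat (poset_cat L)) Grp)
     (\<lambda>K L t. precomp_ftor (op_cat (poset_cat L)) (op_cat (poset_cat K)) Grp
        (op_ftor (poset_ftor L t)))"

end

theory Submission
  imports Defs
begin

text \<open>
  A diagram \<open>F : L\<^sup>o\<^sup>p \<rightarrow> Grp\<close> gives the Clifford monoid of pairs \<open>(e, x)\<close> with \<open>x \<in> F e\<close>, in which
  the factors of a product are restricted to the meet of their indices and multiplied there. This
  is the object part of a functor from the total category to \<open>Cliff\<close>, which is fully faithful and
  essentially surjective. For fullness, \<open>(e, x)\<close> and the idempotent \<open>(e, 1)\<close> divide each other, so
  the first component of the image of \<open>(e, x)\<close> under a homomorphism depends only on \<open>e\<close>.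
  Essential surjectivity is Clifford's theorem: \<open>M\<close> is the disjoint union of the groups
  \<open>{x. x x\<^sup>* = e}\<close> over its idempotents \<open>e\<close>, with restriction maps \<open>x \<mapsto> m x\<close>. As the underlying
  sets are subsets of a fixed infinite type \<open>'a\<close>, pairs are encoded by an injection \<open>'a \<times> 'a \<rightarrow> 'a\<close>.
\<close>

section \<open>Functors\<close>

text \<open>A quasi-inverse written down by hand would call for isomorphisms of diagrams, that is,
  semilattice isomorphisms with natural isomorphisms lying over them. With full faithfulness and
  essential surjectivity, the only isomorphisms to exhibit are bijective monoid homomorphisms. That
  homomorphisms of the monoids of pairs know about restriction maps is due to products of elements
  with different indices: for m \<le> e, the product of (m, 1) and (e, x) is (m, x restricted to m).
  So a multiplicative map must commute with restriction, and this is where naturality comes from in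
  the proof of fullness. Conversely, naturality is what makes the map induced by an arrow of
  diagrams multiplicative. Functors, transformations and homomorphisms are all cut down to their
  domains. Reindexing along identities and composites is therefore governed by equalities, and the
  total category involves no coherence isomorphisms.\<close>

lemma fobj_mk_ftor [simp]: "X \<in> Obj A \<Longrightarrow> fobj (mk_ftor A Fo Fm) X = Fo X"
  by (simp add: mk_ftor_def)

lemma fmap_mk_ftor [simp]:
  "\<lbrakk>X \<in> Obj A; Y \<in> Obj A; f \<in> Hom A X Y\<rbrakk> \<Longrightarrow> fmap (mk_ftor A Fo Fm) X Y f = Fm X Y f"
  by (simp add: mk_ftor_def)

lemma mk_ftor_cong:
  assumes "\<And>X. X \<in> Obj A \<Longrightarrow> Fo X = Go X"
    and "\<And>X Y f. \<lbrakk>X \<in> Obj A; Y \<in> Obj A; f \<in> Hom A X Y\<rbrakk> \<Longrightarrow> Fm X Y f = Gm X Y f"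
  shows "mk_ftor A Fo Fm = mk_ftor A Go Gm"
  using assms by (simp add: mk_ftor_def fun_eq_iff restrict_def)

lemma is_functor_mk_ftor:
  assumes "category A"
    and "\<And>X. X \<in> Obj A \<Longrightarrow> Fo X \<in> Obj B"
    and "\<And>X Y f. \<lbrakk>X \<in> Obj A; Y \<in> Obj A; f \<in> Hom A X Y\<rbrakk> \<Longrightarrow> Fm X Y f \<in> Hom B (Fo X) (Fo Y)"
    and "\<And>X. X \<in> Obj A \<Longrightarrow> Fm X X (Ident A X) = Ident B (Fo X)"
    and "\<And>X Y Z f g. \<lbrakk>X \<in> Obj A; Y \<in> Obj A; Z \<in> Obj A; f \<in> Hom A X Y; g \<in> Hom A Y Z\<rbrakk>
      \<Longrightarrow> Fm X Z (Comp A X Y Z g f) = Comp B (Fo X) (Fo Y) (Fo Z) (Fm Y Z g) (Fm X Y f)"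
  shows "is_functor A B (mk_ftor A Fo Fm)"
proof -
  interpret category A by fact
  have "mk_ftor A Fo Fm = mk_ftor A (fobj (mk_ftor A Fo Fm)) (fmap (mk_ftor A Fo Fm))"
    by (rule mk_ftor_cong) simp_all
  then show ?thesis
    using assms(2-) Ident_in Comp_in by (simp add: is_functor_def)
qed

lemma is_functor_Obj: "\<lbrakk>is_functor A B F; X \<in> Obj A\<rbrakk> \<Longrightarrow> fobj F X \<in> Obj B"
  by (simp add: is_functor_def)

lemma is_functor_Hom:
  "\<lbrakk>is_functor A B F; X \<in> Obj A; Y \<in> Obj A; f \<in> Hom A X Y\<rbrakk>
    \<Longrightarrow> fmap F X Y f \<in> Hom B (fobj F X) (fobj F Y)"
  by (simp add: is_functor_def)

lemma is_functor_Ident: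
  "\<lbrakk>is_functor A B F; X \<in> Obj A\<rbrakk> \<Longrightarrow> fmap F X X (Ident A X) = Ident B (fobj F X)"
  by (simp add: is_functor_def)

lemma is_functor_Comp:
  "\<lbrakk>is_functor A B F; X \<in> Obj A; Y \<in> Obj A; Z \<in> Obj A; f \<in> Hom A X Y; g \<in> Hom A Y Z\<rbrakk>
    \<Longrightarrow> fmap F X Z (Comp A X Y Z g f) =
      Comp B (fobj F X) (fobj F Y) (fobj F Z) (fmap F Y Z g) (fmap F X Y f)"
  by (simp add: is_functor_def)

lemma is_functor_comp_ftor:
  assumes "category A" "is_functor A B F" "is_functor B D G"
  shows "is_functor A D (comp_ftor A G F)"
  unfolding comp_ftor_def
proof (rule is_functor_mk_ftor)
qed (simp_all add: assms is_functor_Obj[OF assms(2)] is_functor_Obj[OF assms(3)]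
    is_functor_Hom[OF assms(2)] is_functor_Hom[OF assms(3)] is_functor_Ident[OF assms(2)]
    is_functor_Ident[OF assms(3)] is_functor_Comp[OF assms(2)] is_functor_Comp[OF assms(3)])

lemma fobj_id_ftor [simp]: "X \<in> Obj A \<Longrightarrow> fobj (id_ftor A) X = X"
  by (simp add: id_ftor_def)

lemma fmap_id_ftor [simp]:
  "\<lbrakk>X \<in> Obj A; Y \<in> Obj A; f \<in> Hom A X Y\<rbrakk> \<Longrightarrow> fmap (id_ftor A) X Y f = f"
  by (simp add: id_ftor_def)

lemma fobj_comp_ftor [simp]: "X \<in> Obj A \<Longrightarrow> fobj (comp_ftor A G F) X = fobj G (fobj F X)"
  by (simp add: comp_ftor_def)

lemma fmap_comp_ftor [simp]:
  "\<lbrakk>X \<in> Obj A; Y \<in> Obj A; f \<in> Hom A X Y\<rbrakk>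
    \<Longrightarrow> fmap (comp_ftor A G F) X Y f = fmap G (fobj F X) (fobj F Y) (fmap F X Y f)"
  by (simp add: comp_ftor_def)

lemma comp_ftor_id_ftor:
  assumes "is_functor A B F"
  shows "comp_ftor A F (id_ftor A) = F"
proof -
  have "comp_ftor A F (id_ftor A) = mk_ftor A (fobj F) (fmap F)"
    unfolding comp_ftor_def by (intro mk_ftor_cong) simp_all
  then show ?thesis
    using assms by (simp add: is_functor_def)
qed

lemma comp_ftor_assoc:
  assumes "is_functor A B F"
  shows "comp_ftor A H (comp_ftor A G F) = comp_ftor A (comp_ftor B H G) F"
  unfolding comp_ftor_def[of A] using assms
  by (intro mk_ftor_cong) (simp_all add: is_functor_Obj is_functor_Hom)

lemma op_cat_simps [simp]:
  "Obj (op_cat C) = Obj C" "Hom (op_cat C) X Y = Hom C Y X" "Ident (op_cat C) = Ident C"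
  "Comp (op_cat C) X Y Z g f = Comp C Z Y X f g"
  by (simp_all add: op_cat_def)

lemma category_op_cat: "category C \<Longrightarrow> category (op_cat C)"
  by (auto simp: category_def op_cat_def)

section \<open>Natural transformations, functor categories and precomposition\<close>

lemma nat_transD:
  assumes "\<alpha> \<in> nat_trans A B F G"
  shows "\<alpha> \<in> extensional (Obj A)"
    and "X \<in> Obj A \<Longrightarrow> \<alpha> X \<in> Hom B (fobj F X) (fobj G X)"
    and "\<lbrakk>X \<in> Obj A; Y \<in> Obj A; f \<in> Hom A X Y\<rbrakk> \<Longrightarrow>
      Comp B (fobj F X) (fobj G X) (fobj G Y) (fmap G X Y f) (\<alpha> X) =
      Comp B (fobj F X) (fobj F Y) (fobj G Y) (\<alpha> Y) (fmap F X Y f)"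
  using assms by (simp_all add: nat_trans_def)

lemma category_Fun_cat:
  assumes "category A" "category B"
  shows "category (Fun_cat A B)"
proof -
  interpret A: category A by fact
  interpret B: category B by fact
  have 1: "Ident (Fun_cat A B) F \<in> Hom (Fun_cat A B) F F" if "F \<in> Obj (Fun_cat A B)" for F
    using that
    by (simp add: Fun_cat_def nat_trans_def is_functor_Obj is_functor_Hom B.Ident_in
        B.Comp_Ident B.Ident_Comp)
  have 2: "Comp (Fun_cat A B) F G H \<beta> \<alpha> \<in> Hom (Fun_cat A B) F H"
    if "F \<in> Obj (Fun_cat A B)" "G \<in> Obj (Fun_cat A B)" "H \<in> Obj (Fun_cat A B)"
      "\<alpha> \<in> Hom (Fun_cat A B) F G" "\<beta> \<in> Hom (Fun_cat A B) G H" for F G H \<alpha> \<beta>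
  proof -
    have F: "is_functor A B F" and G: "is_functor A B G" and H: "is_functor A B H"
      and a: "\<alpha> \<in> nat_trans A B F G" and b: "\<beta> \<in> nat_trans A B G H"
      using that by (simp_all add: Fun_cat_def)
    note obj = F[THEN is_functor_Obj] G[THEN is_functor_Obj] H[THEN is_functor_Obj]
    note hom = F[THEN is_functor_Hom] G[THEN is_functor_Hom] H[THEN is_functor_Hom]
      nat_transD(2)[OF a] nat_transD(2)[OF b]
    \<comment> \<open>Pasting of two naturality squares: the arrow first moves past \<beta>, then
      past \<alpha>.\<close>
    have "Comp B (fobj F X) (fobj H X) (fobj H Y) (fmap H X Y f)
        (Comp B (fobj F X) (fobj G X) (fobj H X) (\<beta> X) (\<alpha> X)) =
      Comp B (fobj F X) (fobj F Y) (fobj H Y)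
        (Comp B (fobj F Y) (fobj G Y) (fobj H Y) (\<beta> Y) (\<alpha> Y)) (fmap F X Y f)"
      (is "?l = ?r") if "X \<in> Obj A" "Y \<in> Obj A" "f \<in> Hom A X Y" for X Y f
    proof -
      have "?l = Comp B (fobj F X) (fobj G X) (fobj H Y)
          (Comp B (fobj G X) (fobj H X) (fobj H Y) (fmap H X Y f) (\<beta> X)) (\<alpha> X)"
        using that by (intro B.Comp_assoc obj hom)
      also have "\<dots> = Comp B (fobj F X) (fobj G X) (fobj H Y)
          (Comp B (fobj G X) (fobj G Y) (fobj H Y) (\<beta> Y) (fmap G X Y f)) (\<alpha> X)"
        using that by (simp add: nat_transD(3)[OF b])
      also have "\<dots> = Comp B (fobj F X) (fobj G Y) (fobj H Y) (\<beta> Y)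
          (Comp B (fobj F X) (fobj G X) (fobj G Y) (fmap G X Y f) (\<alpha> X))"
        using that by (intro B.Comp_assoc[symmetric] obj hom)
      also have "\<dots> = Comp B (fobj F X) (fobj G Y) (fobj H Y) (\<beta> Y)
          (Comp B (fobj F X) (fobj F Y) (fobj G Y) (\<alpha> Y) (fmap F X Y f))"
        using that by (simp add: nat_transD(3)[OF a])
      also have "\<dots> = ?r"
        using that by (intro B.Comp_assoc obj hom)
      finally show ?thesis .
    qed
    then show ?thesis
      by (simp add: Fun_cat_def nat_trans_def B.Comp_in obj hom)
  qed
  show ?thesis
  proof
    show "Comp (Fun_cat A B) F F G \<alpha> (Ident (Fun_cat A B) F) = \<alpha>"
      if "F \<in> Obj (Fun_cat A B)" "G \<in> Obj (Fun_cat A B)" "\<alpha> \<in> Hom (Fun_cat A B) F G" for F G \<alpha>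
      using that
      by (intro extensionalityI[of _ "Obj A"])
        (auto simp: Fun_cat_def nat_trans_def is_functor_Obj B.Comp_Ident)
    show "Comp (Fun_cat A B) F G G (Ident (Fun_cat A B) G) \<alpha> = \<alpha>"
      if "F \<in> Obj (Fun_cat A B)" "G \<in> Obj (Fun_cat A B)" "\<alpha> \<in> Hom (Fun_cat A B) F G" for F G \<alpha>
      using that
      by (intro extensionalityI[of _ "Obj A"])
        (auto simp: Fun_cat_def nat_trans_def is_functor_Obj B.Ident_Comp)
    show "Comp (Fun_cat A B) E G H \<gamma> (Comp (Fun_cat A B) E F G \<beta> \<alpha>) =
      Comp (Fun_cat A B) E F H (Comp (Fun_cat A B) F G H \<gamma> \<beta>) \<alpha>"
      if "E \<in> Obj (Fun_cat A B)" "F \<in> Obj (Fun_cat A B)" "G \<in> Obj (Fun_cat A B)"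
        "H \<in> Obj (Fun_cat A B)" "\<alpha> \<in> Hom (Fun_cat A B) E F" "\<beta> \<in> Hom (Fun_cat A B) F G"
        "\<gamma> \<in> Hom (Fun_cat A B) G H" for E F G H \<alpha> \<beta> \<gamma>
      using that
      by (auto simp: Fun_cat_def nat_transD(2) is_functor_Obj
          intro!: restrict_ext B.Comp_assoc)
  qed (use 1 2 in blast)+
qed

lemma is_functor_precomp_ftor:
  assumes "category A" "category B" "category D" "is_functor A B T"
  shows "is_functor (Fun_cat B D) (Fun_cat A D) (precomp_ftor A B D T)"
  unfolding precomp_ftor_def
proof (rule is_functor_mk_ftor)
  show "category (Fun_cat B D)"
    using assms by (intro category_Fun_cat)
  show "comp_ftor A G T \<in> Obj (Fun_cat A D)" if "G \<in> Obj (Fun_cat B D)" for G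
    using that assms by (simp add: Fun_cat_def is_functor_comp_ftor)
qed (use assms(4) in \<open>auto simp: Fun_cat_def nat_trans_def is_functor_Obj is_functor_Hom
    intro!: restrict_ext\<close>)

lemma fobj_precomp_ftor [simp]:
  "is_functor B D G \<Longrightarrow> fobj (precomp_ftor A B D T) G = comp_ftor A G T"
  by (simp add: precomp_ftor_def Fun_cat_def)

lemma fmap_precomp_ftor [simp]:
  "\<lbrakk>is_functor B D G; is_functor B D H; \<alpha> \<in> nat_trans B D G H\<rbrakk>
    \<Longrightarrow> fmap (precomp_ftor A B D T) G H \<alpha> = (\<lambda>X\<in>Obj A. \<alpha> (fobj T X))"
  by (simp add: precomp_ftor_def Fun_cat_def)

lemma precomp_ftor_id_ftor:
  assumes "category A" "category D"
  shows "precomp_ftor A A D (id_ftor A) = id_ftor (Fun_cat A D)"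
  unfolding precomp_ftor_def id_ftor_def[of "Fun_cat A D"]
  by (rule mk_ftor_cong)
    (auto simp: Fun_cat_def comp_ftor_id_ftor nat_trans_def intro!: extensionalityI[of _ "Obj A"])

text \<open>On objects this is associativity of composition of functors; on arrows both sides
  evaluate \<alpha> at the image of \<open>X\<close> under \<open>S\<close> and then
  \<open>T\<close>. Being an equality, it makes reindexing strictly functorial.\<close>

lemma precomp_ftor_comp_ftor:
  assumes "category A" "category B" "is_functor A B S" "is_functor B B' T"
  shows "precomp_ftor A B' D (comp_ftor A T S) =
    comp_ftor (Fun_cat B' D) (precomp_ftor A B D S) (precomp_ftor B B' D T)"
  unfolding precomp_ftor_def[of A B' D] comp_ftor_def[of "Fun_cat B' D"]
proof (rule mk_ftor_cong)
  fix G assume "G \<in> Obj (Fun_cat B' D)"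
  then have G: "is_functor B' D G" by (simp add: Fun_cat_def)
  then have "is_functor B D (comp_ftor B G T)"
    using assms is_functor_comp_ftor by blast
  with G show "comp_ftor A G (comp_ftor A T S) =
    fobj (precomp_ftor A B D S) (fobj (precomp_ftor B B' D T) G)"
    using assms by (simp add: comp_ftor_assoc)
  fix H \<alpha> assume "H \<in> Obj (Fun_cat B' D)" and \<alpha>: "\<alpha> \<in> Hom (Fun_cat B' D) G H"
  then have H: "is_functor B' D H" by (simp add: Fun_cat_def)
  then have "is_functor B D (comp_ftor B H T)"
    using assms is_functor_comp_ftor by blast
  \<comment> \<open>\<open>fmap_precomp_ftor\<close> computes only on genuine transformations, so
    precomposition with \<open>S\<close> can be evaluated only once the whiskered \<alpha> is known
    to be one.\<close>
  moreover have "(\<lambda>X\<in>Obj B. \<alpha> (fobj T X)) \<in> nat_trans B D (comp_ftor B G T) (comp_ftor B H T)"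
    using \<alpha> assms(4)
    by (auto simp: Fun_cat_def nat_trans_def is_functor_Obj is_functor_Hom)
  ultimately show "(\<lambda>X\<in>Obj A. \<alpha> (fobj (comp_ftor A T S) X)) =
    fmap (precomp_ftor A B D S) (fobj (precomp_ftor B B' D T) G) (fobj (precomp_ftor B B' D T) H)
      (fmap (precomp_ftor B B' D T) G H \<alpha>)"
    using G H \<alpha> \<open>is_functor B D (comp_ftor B G T)\<close> assms(3)
    by (auto simp: Fun_cat_def is_functor_Obj intro!: restrict_ext)
qed

section \<open>The total category\<close>

text \<open>Since \<open>fid\<close> and \<open>fcomp\<close> are equalities, reindexing along a
  composite is literally reindexing in two stages, and second components compose without mediating
  isomorphisms. Each law splits into the law of \<open>C\<close> and that of a fibre; associativity
  also uses that reindexing preserves composites.\<close>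

lemma category_Grothendieck:
  assumes "category C" and F: "is_functor (op_cat C) Cat F"
  shows "category (Grothendieck C F)"
proof -
  interpret C: category C by fact
  have fib: "category (fobj F c)" if "c \<in> Obj C" for c
    using is_functor_Obj[OF F, of c] that by (simp add: Cat_def)
  have fu: "is_functor (fobj F d) (fobj F c) (fmap F d c f)"
    if "c \<in> Obj C" "d \<in> Obj C" "f \<in> Hom C c d" for c d f
    using is_functor_Hom[OF F, of d c f] that by (simp add: Cat_def)
  have fid: "fmap F c c (Ident C c) = id_ftor (fobj F c)" if "c \<in> Obj C" for c
    using is_functor_Ident[OF F, of c] that by (simp add: Cat_def)
  have fcomp: "fmap F e c (Comp C c d e g f) = comp_ftor (fobj F e) (fmap F d c f) (fmap F e d g)"
    if "c \<in> Obj C" "d \<in> Obj C" "e \<in> Obj C" "f \<in> Hom C c d" "g \<in> Hom C d e" for c d e f g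
    using is_functor_Comp[OF F, of e d c g f] that by (simp add: Cat_def)
  note fuo = is_functor_Obj[OF fu] and fuh = is_functor_Hom[OF fu]
  show ?thesis
  proof
    fix X assume "X \<in> Obj (Grothendieck C F)"
    then show "Ident (Grothendieck C F) X \<in> Hom (Grothendieck C F) X X"
      by (auto simp: Grothendieck_def C.Ident_in fid fib category.Ident_in)
  next
    fix X Y Z p q
    assume "X \<in> Obj (Grothendieck C F)" "Y \<in> Obj (Grothendieck C F)" "Z \<in> Obj (Grothendieck C F)"
      "p \<in> Hom (Grothendieck C F) X Y" "q \<in> Hom (Grothendieck C F) Y Z"
    then show "Comp (Grothendieck C F) X Y Z q p \<in> Hom (Grothendieck C F) X Z"
      by (auto simp: Grothendieck_def C.Comp_in fcomp intro!: category.Comp_in[OF fib] fuo fuh)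
  next
    fix X Y p
    assume "X \<in> Obj (Grothendieck C F)" "Y \<in> Obj (Grothendieck C F)" "p \<in> Hom (Grothendieck C F) X Y"
    then show "Comp (Grothendieck C F) X X Y p (Ident (Grothendieck C F) X) = p"
      by (auto simp: Grothendieck_def C.Comp_Ident fid fib fuo category.Comp_Ident)
  next
    fix X Y p
    assume "X \<in> Obj (Grothendieck C F)" "Y \<in> Obj (Grothendieck C F)" "p \<in> Hom (Grothendieck C F) X Y"
    then show "Comp (Grothendieck C F) X Y Y (Ident (Grothendieck C F) Y) p = p"
      by (auto simp: Grothendieck_def C.Ident_Comp fid fib fuo is_functor_Ident[OF fu]
          category.Ident_Comp)
  next
    fix W X Y Z p q r
    assume "W \<in> Obj (Grothendieck C F)" "X \<in> Obj (Grothendieck C F)" "Y \<in> Obj (Grothendieck C F)"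
      "Z \<in> Obj (Grothendieck C F)" "p \<in> Hom (Grothendieck C F) W X"
      "q \<in> Hom (Grothendieck C F) X Y" "r \<in> Hom (Grothendieck C F) Y Z"
    then show "Comp (Grothendieck C F) W Y Z r (Comp (Grothendieck C F) W X Y q p) =
      Comp (Grothendieck C F) W X Z (Comp (Grothendieck C F) X Y Z r q) p"
      by (auto simp: Grothendieck_def C.Comp_assoc fcomp fuo fuh is_functor_Comp[OF fu]
          intro!: category.Comp_assoc[OF fib])
  qed
qed

section \<open>Fully faithful and essentially surjective functors\<close>

text \<open>The quasi-inverse sends an arrow \<open>k\<close> to the preimage under \<open>F\<close>
  of \<open>k\<close> conjugated by chosen isomorphisms. Fullness provides preimages, and
  faithfulness allows every equation in \<open>C\<close> to be checked after applying
  \<open>F\<close>, where the chosen isomorphisms cancel.\<close>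

lemma equivalent_catsI:
  assumes "category C" "category D" "is_functor C D F"
    and full: "\<And>X Y g. \<lbrakk>X \<in> Obj C; Y \<in> Obj C; g \<in> Hom D (fobj F X) (fobj F Y)\<rbrakk>
      \<Longrightarrow> \<exists>f\<in>Hom C X Y. fmap F X Y f = g"
    and faithful: "\<And>X Y f f'. \<lbrakk>X \<in> Obj C; Y \<in> Obj C; f \<in> Hom C X Y; f' \<in> Hom C X Y;
        fmap F X Y f = fmap F X Y f'\<rbrakk> \<Longrightarrow> f = f'"
    and ess_surj: "\<And>Y. Y \<in> Obj D \<Longrightarrow> \<exists>X\<in>Obj C. \<exists>e. is_iso D (fobj F X) Y e"
  shows "equivalent_cats C D"
proof -
  interpret C: category C by fact
  interpret D: category D by fact
  note F = is_functor_Obj[OF assms(3)] is_functor_Hom[OF assms(3)]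
    is_functor_Ident[OF assms(3)] is_functor_Comp[OF assms(3)]
  have "\<exists>X e i. X \<in> Obj C \<and> e \<in> Hom D (fobj F X) Y \<and> i \<in> Hom D Y (fobj F X) \<and>
      Comp D (fobj F X) Y (fobj F X) i e = Ident D (fobj F X) \<and>
      Comp D Y (fobj F X) Y e i = Ident D Y" if "Y \<in> Obj D" for Y
    using ess_surj[OF that] unfolding is_iso_def by blast
  then obtain g e i where g: "\<And>Y. Y \<in> Obj D \<Longrightarrow> g Y \<in> Obj C"
    and e: "\<And>Y. Y \<in> Obj D \<Longrightarrow> e Y \<in> Hom D (fobj F (g Y)) Y"
    and i: "\<And>Y. Y \<in> Obj D \<Longrightarrow> i Y \<in> Hom D Y (fobj F (g Y))"
    and ie: "\<And>Y. Y \<in> Obj D \<Longrightarrow>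
      Comp D (fobj F (g Y)) Y (fobj F (g Y)) (i Y) (e Y) = Ident D (fobj F (g Y))"
    and ei: "\<And>Y. Y \<in> Obj D \<Longrightarrow> Comp D Y (fobj F (g Y)) Y (e Y) (i Y) = Ident D Y"
    by metis
  have ie': "Comp D X Y (fobj F (g Y)) (i Y) (Comp D X (fobj F (g Y)) Y (e Y) f) = f"
    if "X \<in> Obj D" "Y \<in> Obj D" "f \<in> Hom D X (fobj F (g Y))" for X Y f
    using that by (simp add: D.Comp_assoc F g e i ie D.Ident_Comp)
  have ei': "Comp D X (fobj F (g Y)) Y (e Y) (Comp D X Y (fobj F (g Y)) (i Y) f) = f"
    if "X \<in> Obj D" "Y \<in> Obj D" "f \<in> Hom D X Y" for X Y f
    using that by (simp add: D.Comp_assoc F g e i ei D.Ident_Comp)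
  \<comment> \<open>The choice is harmless: by \<open>faithful\<close> there is at most one
    preimage.\<close>
  define P where "P X Y k = (SOME f. f \<in> Hom C X Y \<and> fmap F X Y f = k)" for X Y k
  have P: "P X Y k \<in> Hom C X Y" "fmap F X Y (P X Y k) = k"
    if "X \<in> Obj C" "Y \<in> Obj C" "k \<in> Hom D (fobj F X) (fobj F Y)" for X Y k
    using someI_ex[OF full[OF that, unfolded Bex_def]] by (simp_all add: P_def)
  define c where "c Y Z k = Comp D (fobj F (g Y)) Z (fobj F (g Z)) (i Z)
      (Comp D (fobj F (g Y)) Y Z k (e Y))" for Y Z k
  have c: "c Y Z k \<in> Hom D (fobj F (g Y)) (fobj F (g Z))"
    if "Y \<in> Obj D" "Z \<in> Obj D" "k \<in> Hom D Y Z" for Y Z k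
    unfolding c_def using that by (intro D.Comp_in[where Y = Z] D.Comp_in[where Y = Y] F g e i)
  define G where "G = mk_ftor D g (\<lambda>Y Z k. P (g Y) (g Z) (c Y Z k))"
  have G: "is_functor D C G"
    unfolding G_def
  proof (rule is_functor_mk_ftor)
    fix X assume X: "X \<in> Obj D"
    have "c X X (Ident D X) = fmap F (g X) (g X) (Ident C (g X))"
      using X by (simp add: c_def D.Ident_Comp e g F ie)
    then show "P (g X) (g X) (c X X (Ident D X)) = Ident C (g X)"
      using X c[OF X X D.Ident_in[OF X]]
      by (intro faithful[of "g X" "g X"]) (simp_all add: g P C.Ident_in)
  next
    fix X Y Z f h
    assume X: "X \<in> Obj D" and Y: "Y \<in> Obj D" and Z: "Z \<in> Obj D"
      and f: "f \<in> Hom D X Y" and h: "h \<in> Hom D Y Z"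
    have eq: "c X Z (Comp D X Y Z h f) =
      Comp D (fobj F (g X)) (fobj F (g Y)) (fobj F (g Z)) (c Y Z h) (c X Y f)"
      using X Y Z f h
      by (simp add: c_def D.Comp_assoc[symmetric] D.Comp_in[where Y = Y] D.Comp_in[where Y = X]
          D.Comp_in[where Y = Z] F g e i ei')
    show "P (g X) (g Z) (c X Z (Comp D X Y Z h f)) =
      Comp C (g X) (g Y) (g Z) (P (g Y) (g Z) (c Y Z h)) (P (g X) (g Y) (c X Y f))"
      using X Y Z f h c[OF X Z D.Comp_in[OF X Y Z f h]]
      by (intro faithful[of "g X" "g Z"])
        (simp_all add: g P c C.Comp_in[where Y = "g Y"] F(4) eq)
  qed (use assms g P c in auto)
  \<comment> \<open>The inverse of the isomorphism chosen for the object F X goes from F X to F (g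
    (F X)); both ends lie in the image of \<open>F\<close>, so it lifts to \<open>C\<close>.\<close>
  define \<eta> where "\<eta> = (\<lambda>X\<in>Obj C. P X (g (fobj F X)) (i (fobj F X)))"
  have \<eta>: "\<eta> \<in> nat_isos C C (id_ftor C) (comp_ftor C G F)"
  proof -
    have obj: "fobj G Y = g Y" if "Y \<in> Obj D" for Y
      using that by (simp add: G_def)
    have iso: "is_iso C X (g (fobj F X)) (\<eta> X)" if X: "X \<in> Obj C" for X
    proof -
      let ?e = "P (g (fobj F X)) X (e (fobj F X))"
      have "?e \<in> Hom C (g (fobj F X)) X" "\<eta> X \<in> Hom C X (g (fobj F X))"
        using X by (simp_all add: \<eta>_def P g e i F)
      moreover have "Comp C X (g (fobj F X)) X ?e (\<eta> X) = Ident C X"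
        using X calculation by (intro faithful[of X X])
          (simp_all add: \<eta>_def P g e i F ei C.Ident_in C.Comp_in[where Y = "g (fobj F X)"])
      moreover have "Comp C (g (fobj F X)) X (g (fobj F X)) (\<eta> X) ?e = Ident C (g (fobj F X))"
        using X calculation by (intro faithful[of "g (fobj F X)" "g (fobj F X)"])
          (simp_all add: \<eta>_def P g e i F ie C.Ident_in C.Comp_in[where Y = X])
      ultimately show ?thesis
        unfolding is_iso_def by blast
    qed
    have nat: "Comp C X (g (fobj F X)) (g (fobj F Y)) (fmap (comp_ftor C G F) X Y f) (\<eta> X) =
        Comp C X Y (g (fobj F Y)) (\<eta> Y) f"
      if X: "X \<in> Obj C" and Y: "Y \<in> Obj C" and f: "f \<in> Hom C X Y" for X Y f
      using X Y f c[of "fobj F X" "fobj F Y" "fmap F X Y f"]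
      by (intro faithful[of X "g (fobj F Y)"])
        (simp_all add: \<eta>_def G_def P g e i F c C.Comp_in[where Y = Y]
          C.Comp_in[where Y = "g (fobj F X)"] c_def D.Comp_assoc[symmetric]
          D.Comp_in[where Y = "fobj F X"] ei D.Comp_Ident)
    show ?thesis
      using iso nat unfolding nat_isos_def nat_trans_def is_iso_def
      by (auto simp: obj F) (simp add: \<eta>_def)
  qed
  have \<epsilon>: "restrict e (Obj D) \<in> nat_isos D D (comp_ftor D F G) (id_ftor D)"
  proof -
    have obj: "fobj G Y = g Y" if "Y \<in> Obj D" for Y
      using that by (simp add: G_def)
    have nat: "Comp D (fobj F (g Y)) Y Z k (e Y) =
      Comp D (fobj F (g Y)) (fobj F (g Z)) Z (e Z) (fmap (comp_ftor D F G) Y Z k)"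
      if "Y \<in> Obj D" "Z \<in> Obj D" "k \<in> Hom D Y Z" for Y Z k
      using that c[OF that]
      by (simp add: G_def P g) (simp add: c_def ei' D.Comp_in[where Y = Y] F g e)
    show ?thesis
      using nat e i ie ei unfolding nat_isos_def nat_trans_def is_iso_def
      by (auto simp: obj intro!: bexI[OF _ i])
  qed
  show ?thesis
    unfolding equivalent_cats_def using assms(1-3) G \<eta> \<epsilon> by blast
qed

section \<open>The functor of diagrams of groups\<close>

lemma category_Mon_cat:
  assumes "\<And>G. G \<in> \<M> \<Longrightarrow> monoid G"
  shows "category (Mon_cat \<M>)"
proof
  show "Ident (Mon_cat \<M>) X \<in> Hom (Mon_cat \<M>) X X" if "X \<in> Obj (Mon_cat \<M>)" for X
    using that assms by (auto simp: Mon_cat_def monoid_homs_def hom_def monoid.m_closed)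
  show "Comp (Mon_cat \<M>) X Y Z g f \<in> Hom (Mon_cat \<M>) X Z"
    if "X \<in> Obj (Mon_cat \<M>)" "f \<in> Hom (Mon_cat \<M>) X Y" "g \<in> Hom (Mon_cat \<M>) Y Z" for X Y Z f g
    using that assms
    by (auto simp: Mon_cat_def monoid_homs_def hom_def compose_def Pi_iff
        intro: monoid.m_closed monoid.one_closed)
  show "Comp (Mon_cat \<M>) X X Y f (Ident (Mon_cat \<M>) X) = f"
    if "f \<in> Hom (Mon_cat \<M>) X Y" for X Y f
    using that
    by (auto simp: Mon_cat_def monoid_homs_def intro: compose_Id)
  show "Comp (Mon_cat \<M>) X Y Y (Ident (Mon_cat \<M>) Y) f = f"
    if "f \<in> Hom (Mon_cat \<M>) X Y" for X Y f
    using that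
    by (auto simp: Mon_cat_def monoid_homs_def hom_def intro: Id_compose)
  show "Comp (Mon_cat \<M>) W Y Z h (Comp (Mon_cat \<M>) W X Y g f) =
    Comp (Mon_cat \<M>) W X Z (Comp (Mon_cat \<M>) X Y Z h g) f"
    if "f \<in> Hom (Mon_cat \<M>) W X" for W X Y Z f g h
    using that by (simp add: Mon_cat_def monoid_homs_def hom_def compose_assoc)
qed

lemma category_Grp: "category Grp"
  unfolding Grp_def by (rule category_Mon_cat) (simp add: group.is_monoid)

lemma category_SLat: "category SLat"
  unfolding SLat_def
  by (rule category_Mon_cat) (simp add: semilattice_monoid_def comm_monoid_def)

lemma category_Cliff: "category Cliff"
  unfolding Cliff_def
  by (rule category_Mon_cat) (simp add: clifford_monoid_def inverse_monoid_def)

section \<open>Semilattices as posets and functoriality of the diagram categories\<close>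

lemma Obj_poset_cat [simp]: "Obj (poset_cat L) = carrier L"
  by (simp add: poset_cat_def)

lemma Hom_poset_cat_iff [simp]: "f \<in> Hom (poset_cat L) e e' \<longleftrightarrow> e = e \<otimes>\<^bsub>L\<^esub> e'"
  by (simp add: poset_cat_def)

lemma category_poset_cat:
  assumes "semilattice_monoid L"
  shows "category (poset_cat L)"
proof -
  interpret semilattice_monoid L by fact
  have "e = e \<otimes>\<^bsub>L\<^esub> e''" if "e = e \<otimes>\<^bsub>L\<^esub> e'" "e' = e' \<otimes>\<^bsub>L\<^esub> e''"
    "e \<in> carrier L" "e' \<in> carrier L" "e'' \<in> carrier L" for e e' e''
    using that m_assoc[of e e' e''] by simp
  then show ?thesis
    by unfold_locales (simp_all add: mult_idem)
qed

lemma is_functor_op_poset_ftor: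
  assumes "semilattice_monoid L" "t \<in> monoid_homs L K"
  shows "is_functor (op_cat (poset_cat L)) (op_cat (poset_cat K)) (op_ftor (poset_ftor L t))"
proof -
  have t: "t x \<in> carrier K" "t (x \<otimes>\<^bsub>L\<^esub> y) = t x \<otimes>\<^bsub>K\<^esub> t y" if "x \<in> carrier L" "y \<in> carrier L" for x y
    using assms(2) that by (auto simp: monoid_homs_def hom_def)
  have "op_ftor (poset_ftor L t) = mk_ftor (op_cat (poset_cat L)) t (\<lambda>_ _ _. ())"
    by (simp add: op_ftor_def poset_ftor_def mk_ftor_def poset_cat_def fun_eq_iff)
  moreover have "is_functor (op_cat (poset_cat L)) (op_cat (poset_cat K))
      (mk_ftor (op_cat (poset_cat L)) t (\<lambda>_ _ _. ()))"
  proof (rule is_functor_mk_ftor)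
    show "() \<in> Hom (op_cat (poset_cat K)) (t X) (t Y)"
      if "X \<in> Obj (op_cat (poset_cat L))" "Y \<in> Obj (op_cat (poset_cat L))"
        "f \<in> Hom (op_cat (poset_cat L)) X Y" for X Y f
      using that t[of Y X] by simp
  qed (use assms t in \<open>simp_all add: category_op_cat category_poset_cat\<close>)
  ultimately show ?thesis
    by simp
qed

lemma op_poset_ftor_Ident:
  "op_ftor (poset_ftor L (\<lambda>x\<in>carrier L. x)) = id_ftor (op_cat (poset_cat L))"
  by (auto simp: op_cat_def poset_cat_def op_ftor_def poset_ftor_def mk_ftor_def id_ftor_def
      fun_eq_iff)

lemma op_poset_ftor_compose:
  assumes "t \<in> monoid_homs L K"
  shows "op_ftor (poset_ftor L (compose (carrier L) s t)) =
    comp_ftor (op_cat (poset_cat L)) (op_ftor (poset_ftor K s)) (op_ftor (poset_ftor L t))"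
  using assms
  by (auto simp: op_cat_def poset_cat_def op_ftor_def poset_ftor_def mk_ftor_def comp_ftor_def
      fun_eq_iff compose_def monoid_homs_def hom_def)

lemma is_functor_Cat_op_Grp:
  "is_functor (op_cat (SLat :: ('a monoid, 'a \<Rightarrow> 'a) cat)) Cat Cat_op_Grp"
  unfolding Cat_op_Grp_def
proof (rule is_functor_mk_ftor)
  show "category (op_cat (SLat :: ('a monoid, 'a \<Rightarrow> 'a) cat))"
    by (intro category_op_cat category_SLat)
  have cat: "category (op_cat (poset_cat L))" if "L \<in> Obj (op_cat SLat)" for L :: "'a monoid"
    using that by (simp add: SLat_def Mon_cat_def category_op_cat category_poset_cat)
  have ftor: "is_functor (op_cat (poset_cat L)) (op_cat (poset_cat K)) (op_ftor (poset_ftor L t))"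
    if "L \<in> Obj (op_cat SLat)" "t \<in> Hom (op_cat SLat) K L" for L K :: "'a monoid" and t
    using that
    by (simp add: SLat_def Mon_cat_def is_functor_op_poset_ftor)
  show "Fun_cat (op_cat (poset_cat L)) Grp \<in> Obj Cat" if "L \<in> Obj (op_cat SLat)" for L :: "'a monoid"
    using that by (simp add: Cat_def category_Fun_cat cat category_Grp)
  show "precomp_ftor (op_cat (poset_cat L)) (op_cat (poset_cat K)) Grp (op_ftor (poset_ftor L t))
      \<in> Hom Cat (Fun_cat (op_cat (poset_cat K)) Grp) (Fun_cat (op_cat (poset_cat L)) Grp)"
    if "K \<in> Obj (op_cat SLat)" "L \<in> Obj (op_cat SLat)" "t \<in> Hom (op_cat SLat) K L"
    for K L :: "'a monoid" and t
    using that by (simp add: Cat_def is_functor_precomp_ftor cat category_Grp ftor)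
  show "precomp_ftor (op_cat (poset_cat L)) (op_cat (poset_cat L)) Grp
      (op_ftor (poset_ftor L (Ident (op_cat SLat) L))) =
      Ident Cat (Fun_cat (op_cat (poset_cat L)) Grp)"
    if "L \<in> Obj (op_cat SLat)" for L :: "'a monoid"
  proof -
    have "Ident (op_cat SLat) L = (\<lambda>x\<in>carrier L. x)"
      by (simp add: SLat_def Mon_cat_def)
    then show ?thesis
      using that
      by (simp add: Cat_def op_poset_ftor_Ident precomp_ftor_id_ftor cat category_Grp)
  qed
  show "precomp_ftor (op_cat (poset_cat M)) (op_cat (poset_cat K)) Grp
      (op_ftor (poset_ftor M (Comp (op_cat SLat) K L M t s))) =
    Comp Cat (Fun_cat (op_cat (poset_cat K)) Grp) (Fun_cat (op_cat (poset_cat L)) Grp)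
      (Fun_cat (op_cat (poset_cat M)) Grp)
      (precomp_ftor (op_cat (poset_cat M)) (op_cat (poset_cat L)) Grp (op_ftor (poset_ftor M t)))
      (precomp_ftor (op_cat (poset_cat L)) (op_cat (poset_cat K)) Grp (op_ftor (poset_ftor L s)))"
    if "K \<in> Obj (op_cat SLat)" "L \<in> Obj (op_cat SLat)" "M \<in> Obj (op_cat SLat)"
      "s \<in> Hom (op_cat SLat) K L" "t \<in> Hom (op_cat SLat) L M"
    for K L M :: "'a monoid" and s t
  proof -
    \<comment> \<open>The composite runs from \<open>K\<close> over \<open>L\<close> to
      \<open>M\<close> in the opposite category, while the underlying functions go from
      \<open>M\<close> over \<open>L\<close> to \<open>K\<close>, so \<open>t\<close> is applied
      first.\<close>
    have "Comp (op_cat SLat) K L M t s = compose (carrier M) s t"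
      by (simp add: SLat_def Mon_cat_def)
    moreover have "t \<in> monoid_homs M L"
      using that by (simp add: SLat_def Mon_cat_def)
    ultimately show ?thesis
      using precomp_ftor_comp_ftor[OF cat cat ftor ftor] that
      by (simp add: Cat_def op_poset_ftor_compose)
  qed
qed

section \<open>The Clifford monoid of a diagram of groups\<close>

locale group_diagram = semilattice_monoid L for L (structure) +
  fixes F :: "('a, unit, 'b monoid, 'b \<Rightarrow> 'b) ftor"
  assumes is_diagram: "is_functor (op_cat (poset_cat L)) Grp F"
begin

text \<open>Covers a factor repeated at the head of a longer meet. Together with the AC rules and
  \<open>mult_idem\<close> it lets the simplifier normalise meets, so that order relations between
  indices become routine.\<close>

lemma left_idem: "\<lbrakk>x \<in> carrier L; y \<in> carrier L\<rbrakk> \<Longrightarrow> x \<otimes> (x \<otimes> y) = x \<otimes> y"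
  by (simp add: m_assoc[symmetric] mult_idem)

lemmas slat_simps = m_ac mult_idem left_idem

lemma group_fobj: "e \<in> carrier L \<Longrightarrow> group (fobj F e)"
  using is_functor_Obj[OF is_diagram, of e] by (simp add: Grp_def Mon_cat_def)

text \<open>An arrow from \<open>e\<close> to \<open>m\<close> in the opposite poset is the single
  value \<open>()\<close> and exists when m \<le> e, that is \<open>m = m \<otimes> e\<close>;
  restriction runs down the semilattice.\<close>

abbreviation res :: "'a \<Rightarrow> 'a \<Rightarrow> 'b \<Rightarrow> 'b" where
  "res e m \<equiv> fmap F e m ()"

lemma res_in_homs:
  "\<lbrakk>e \<in> carrier L; m \<in> carrier L; m = m \<otimes> e\<rbrakk> \<Longrightarrow> res e m \<in> monoid_homs (fobj F e) (fobj F m)"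
  using is_functor_Hom[OF is_diagram, of e m "()"] by (simp add: Grp_def Mon_cat_def)

lemma
  assumes "e \<in> carrier L" "m \<in> carrier L" "m = m \<otimes> e"
  shows res_closed: "x \<in> carrier (fobj F e) \<Longrightarrow> res e m x \<in> carrier (fobj F m)"
    and res_mult: "\<lbrakk>x \<in> carrier (fobj F e); y \<in> carrier (fobj F e)\<rbrakk>
      \<Longrightarrow> res e m (x \<otimes>\<^bsub>fobj F e\<^esub> y) = res e m x \<otimes>\<^bsub>fobj F m\<^esub> res e m y"
    and res_one: "res e m \<one>\<^bsub>fobj F e\<^esub> = \<one>\<^bsub>fobj F m\<^esub>"
  using res_in_homs[OF assms] by (auto simp: monoid_homs_def hom_def)

lemma res_id: "\<lbrakk>e \<in> carrier L; x \<in> carrier (fobj F e)\<rbrakk> \<Longrightarrow> res e e x = x"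
  using is_functor_Ident[OF is_diagram, of e] by (simp add: Grp_def Mon_cat_def poset_cat_def)

lemma res_res:
  assumes "e \<in> carrier L" "m \<in> carrier L" "n \<in> carrier L" "m = m \<otimes> e" "n = n \<otimes> m"
    "x \<in> carrier (fobj F e)"
  shows "res m n (res e m x) = res e n x"
  using is_functor_Comp[OF is_diagram, of e m n "()" "()"] assms
  by (simp add: Grp_def Mon_cat_def compose_def)

end

text \<open>
  The injection \<open>p\<close> encodes an element \<open>x\<close> of the group at \<open>e\<close> as the element \<open>p (e, x)\<close> of the
  disjoint union.
\<close>

definition total_monoid ::
    "('a \<times> 'b \<Rightarrow> 'c) \<Rightarrow> 'a monoid \<Rightarrow> ('a, unit, 'b monoid, 'b \<Rightarrow> 'b) ftor \<Rightarrow> 'c monoid" where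
  "total_monoid p L F = \<lparr>carrier = p ` (SIGMA e:carrier L. carrier (fobj F e)),
     mult = (\<lambda>z w. case (inv_into UNIV p z, inv_into UNIV p w) of ((e, x), (f, y)) \<Rightarrow>
       let m = e \<otimes>\<^bsub>L\<^esub> f in p (m, fmap F e m () x \<otimes>\<^bsub>fobj F m\<^esub> fmap F f m () y)),
     one = p (\<one>\<^bsub>L\<^esub>, \<one>\<^bsub>fobj F \<one>\<^bsub>L\<^esub>\<^esub>)\<rparr>"

locale encoded_group_diagram = group_diagram L F for L (structure) and F +
  fixes p :: "'a \<times> 'b \<Rightarrow> 'c"
  assumes inj_p: "inj p"
begin

abbreviation T :: "'c monoid" where
  "T \<equiv> total_monoid p L F"

lemma p_eq [simp]: "p u = p v \<longleftrightarrow> u = v"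
  using inj_p by (simp add: inj_eq)

lemma inv_p [simp]: "inv_into UNIV p (p u) = u"
  using inj_p by simp

lemma p_in_carrier [simp]: "p (e, x) \<in> carrier T \<longleftrightarrow> e \<in> carrier L \<and> x \<in> carrier (fobj F e)"
  by (auto simp: total_monoid_def)

lemma total_cases:
  assumes "z \<in> carrier T"
  obtains e x where "z = p (e, x)" "e \<in> carrier L" "x \<in> carrier (fobj F e)"
  using assms by (auto simp: total_monoid_def)

lemma total_mult [simp]:
  "p (e, x) \<otimes>\<^bsub>T\<^esub> p (f, y) =
    p (e \<otimes> f, res e (e \<otimes> f) x \<otimes>\<^bsub>fobj F (e \<otimes> f)\<^esub> res f (e \<otimes> f) y)"
  by (simp add: total_monoid_def Let_def)

text \<open>With equal indices the meet is \<open>e\<close> and both restrictions are identities, so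
  each group lies inside \<open>T\<close> with its own multiplication. Group laws then apply
  directly, provided the general rule \<open>total_mult\<close> is kept from firing.\<close>

lemma total_mult_same:
  assumes "e \<in> carrier L" "x \<in> carrier (fobj F e)" "y \<in> carrier (fobj F e)"
  shows "p (e, x) \<otimes>\<^bsub>T\<^esub> p (e, y) = p (e, x \<otimes>\<^bsub>fobj F e\<^esub> y)"
  using assms by (simp add: mult_idem res_id)

lemma total_one: "\<one>\<^bsub>T\<^esub> = p (\<one>, \<one>\<^bsub>fobj F \<one>\<^esub>)"
  by (simp add: total_monoid_def)

text \<open>For associativity, restrictions are multiplicative and compose, so either bracketing
  yields the product of the three entries restricted to the common meet \<open>?m\<close>. The unit
  sits at the top index and restricts to the unit of every group.\<close>

lemma monoid_total: "Group.monoid T"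
proof
  fix z w assume "z \<in> carrier T" "w \<in> carrier T"
  then show "z \<otimes>\<^bsub>T\<^esub> w \<in> carrier T"
    by (auto elim!: total_cases intro!: monoid.m_closed[OF group.is_monoid, OF group_fobj] res_closed
        simp: slat_simps)
next
  show "\<one>\<^bsub>T\<^esub> \<in> carrier T"
    by (simp add: total_one monoid.one_closed group.is_monoid group_fobj)
next
  fix z assume "z \<in> carrier T"
  then show "\<one>\<^bsub>T\<^esub> \<otimes>\<^bsub>T\<^esub> z = z" "z \<otimes>\<^bsub>T\<^esub> \<one>\<^bsub>T\<^esub> = z"
    by (auto elim!: total_cases
        simp: total_one res_one res_id monoid.l_one monoid.r_one group.is_monoid group_fobj)
next
  fix a b c assume "a \<in> carrier T" "b \<in> carrier T" "c \<in> carrier T"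
  then obtain e x f y g z where
    eq: "a = p (e, x)" "b = p (f, y)" "c = p (g, z)"
    and e: "e \<in> carrier L" "x \<in> carrier (fobj F e)"
    and f: "f \<in> carrier L" "y \<in> carrier (fobj F f)"
    and g: "g \<in> carrier L" "z \<in> carrier (fobj F g)"
    by (metis total_cases)
  let ?m = "e \<otimes> (f \<otimes> g)"
  interpret m: group "fobj F ?m"
    by (rule group_fobj) (simp add: e f g)
  have 1: "res (e \<otimes> f) ?m (res e (e \<otimes> f) x \<otimes>\<^bsub>fobj F (e \<otimes> f)\<^esub> res f (e \<otimes> f) y) =
      res e ?m x \<otimes>\<^bsub>fobj F ?m\<^esub> res f ?m y"
    using e f g by (simp add: res_mult res_closed res_res slat_simps)
  have 2: "res (f \<otimes> g) ?m (res f (f \<otimes> g) y \<otimes>\<^bsub>fobj F (f \<otimes> g)\<^esub> res g (f \<otimes> g) z) =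
      res f ?m y \<otimes>\<^bsub>fobj F ?m\<^esub> res g ?m z"
    using e f g by (simp add: res_mult res_closed res_res slat_simps)
  have 3: "res e ?m x \<in> carrier (fobj F ?m)" "res f ?m y \<in> carrier (fobj F ?m)"
    "res g ?m z \<in> carrier (fobj F ?m)"
    using e f g by (simp_all add: res_closed slat_simps)
  show "a \<otimes>\<^bsub>T\<^esub> b \<otimes>\<^bsub>T\<^esub> c = a \<otimes>\<^bsub>T\<^esub> (b \<otimes>\<^bsub>T\<^esub> c)"
    using e f g 3 by (simp add: eq m_assoc 1 2 m.m_assoc)
qed

text \<open>Inverses are taken inside each group. An idempotent must be the unit of its group, since
  it is idempotent there; multiplying by it on either side merely restricts the other factor to the
  meet, hence it is central.\<close>

lemma clifford_total: "clifford_monoid T"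
proof -
  interpret T: Group.monoid T by (rule monoid_total)
  show ?thesis
  proof
    fix a assume "a \<in> carrier T"
    then obtain e x where a: "a = p (e, x)" and e: "e \<in> carrier L" and x: "x \<in> carrier (fobj F e)"
      by (rule total_cases)
    interpret G: group "fobj F e" by (rule group_fobj) (rule e)
    show "\<exists>!b. b \<in> carrier T \<and> a \<otimes>\<^bsub>T\<^esub> b \<otimes>\<^bsub>T\<^esub> a = a \<and> b \<otimes>\<^bsub>T\<^esub> a \<otimes>\<^bsub>T\<^esub> b = b"
    proof (rule ex1I)
      show "p (e, inv\<^bsub>fobj F e\<^esub> x) \<in> carrier T \<and>
        a \<otimes>\<^bsub>T\<^esub> p (e, inv\<^bsub>fobj F e\<^esub> x) \<otimes>\<^bsub>T\<^esub> a = a \<and>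
        p (e, inv\<^bsub>fobj F e\<^esub> x) \<otimes>\<^bsub>T\<^esub> a \<otimes>\<^bsub>T\<^esub> p (e, inv\<^bsub>fobj F e\<^esub> x) = p (e, inv\<^bsub>fobj F e\<^esub> x)"
        using e x by (simp add: a total_mult_same del: total_mult)
    next
      fix b assume b: "b \<in> carrier T \<and> a \<otimes>\<^bsub>T\<^esub> b \<otimes>\<^bsub>T\<^esub> a = a \<and> b \<otimes>\<^bsub>T\<^esub> a \<otimes>\<^bsub>T\<^esub> b = b"
      then obtain f y where bf: "b = p (f, y)" and f: "f \<in> carrier L" and y: "y \<in> carrier (fobj F f)"
        using total_cases by blast
      \<comment> \<open>The index components of the two inverse equations say e \<le> f and f \<le>
        e; what remains is uniqueness of inverses in one group.\<close>
      have "e \<otimes> f \<otimes> e = e" "f \<otimes> e \<otimes> f = f"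
        using b by (simp_all add: a bf)
      then have fe: "f = e"
        using e f by (simp add: slat_simps)
      have y: "y \<in> carrier (fobj F e)"
        using y fe by simp
      then have "x \<otimes>\<^bsub>fobj F e\<^esub> y \<otimes>\<^bsub>fobj F e\<^esub> x = x"
        using b e x by (simp add: a bf fe total_mult_same del: total_mult)
      then have "x \<otimes>\<^bsub>fobj F e\<^esub> y = \<one>\<^bsub>fobj F e\<^esub>"
        using x y by simp
      then have "y = inv\<^bsub>fobj F e\<^esub> x"
        using x y by (metis G.inv_comm G.inv_equality)
      then show "b = p (e, inv\<^bsub>fobj F e\<^esub> x)"
        by (simp add: bf fe)
    qed
  next
    fix a b assume "a \<in> carrier T" and idem: "a \<otimes>\<^bsub>T\<^esub> a = a" and "b \<in> carrier T"
    then obtain e x f y where a: "a = p (e, x)" and e: "e \<in> carrier L" "x \<in> carrier (fobj F e)"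
      and b: "b = p (f, y)" and f: "f \<in> carrier L" "y \<in> carrier (fobj F f)"
      by (metis total_cases)
    interpret G: group "fobj F e" by (rule group_fobj) (rule e)
    interpret H: group "fobj F (e \<otimes> f)" by (rule group_fobj) (simp add: e f)
    have "x = \<one>\<^bsub>fobj F e\<^esub>"
      using idem e by (simp add: a total_mult_same del: total_mult)
    moreover have "res f (e \<otimes> f) y \<in> carrier (fobj F (e \<otimes> f))"
      using e f by (simp add: res_closed slat_simps)
    moreover have "f \<otimes> e = e \<otimes> f"
      using e f by (simp add: m_comm)
    ultimately show "a \<otimes>\<^bsub>T\<^esub> b = b \<otimes>\<^bsub>T\<^esub> a"
      using e f by (simp add: a b res_one slat_simps)
  qed
qed

end

section \<open>The functor to Clifford monoids\<close>

type_synonym 'a diagram = "'a monoid \<times> ('a, unit, 'a monoid, 'a \<Rightarrow> 'a) ftor"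

abbreviation diagrams :: "('a diagram,
    ('a \<Rightarrow> 'a) \<times> ('a \<Rightarrow> 'a \<Rightarrow> 'a)) cat" where
  "diagrams \<equiv> Grothendieck SLat Cat_op_Grp"

section \<open>Arrows of the total category in elementwise terms\<close>

lemma Obj_SLat [simp]: "L \<in> Obj SLat \<longleftrightarrow> semilattice_monoid L"
  by (simp add: SLat_def Mon_cat_def)

lemma Hom_SLat [simp]: "Hom SLat L K = monoid_homs L K"
  by (simp add: SLat_def Mon_cat_def)

lemma Obj_diagrams [simp]: "(L, F) \<in> Obj diagrams \<longleftrightarrow> group_diagram L F"
  by (auto simp: Grothendieck_def Cat_op_Grp_def Fun_cat_def group_diagram_def
      group_diagram_axioms_def)

lemma fobj_op_poset_ftor [simp]: "e \<in> carrier L \<Longrightarrow> fobj (op_ftor (poset_ftor L t)) e = t e"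
  by (simp add: op_ftor_def poset_ftor_def)

lemma Grp_simps [simp]: "Obj Grp = {G. group G}" "Hom Grp = monoid_homs"
  "Ident Grp G = (\<lambda>x\<in>carrier G. x)" "Comp Grp G H K g f = compose (carrier G) g f"
  by (simp_all add: Grp_def Mon_cat_def)

lemma compose_eq_compose_iff:
  "compose A g f = compose A g' f' \<longleftrightarrow> (\<forall>x\<in>A. g (f x) = g' (f' x))"
  by (auto simp: compose_def fun_eq_iff restrict_def)

lemma Hom_diagrams_nat_trans:
  assumes "group_diagram L F" "group_diagram K G"
  shows "(t, \<alpha>) \<in> Hom diagrams (L, F) (K, G) \<longleftrightarrow> t \<in> monoid_homs L K \<and>
    \<alpha> \<in> nat_trans (op_cat (poset_cat L)) Grp F
      (comp_ftor (op_cat (poset_cat L)) G (op_ftor (poset_ftor L t)))"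
proof -
  interpret L: group_diagram L F by fact
  interpret K: group_diagram K G by fact
  show ?thesis
    by (auto simp: Grothendieck_def Cat_op_Grp_def Fun_cat_def
        K.is_diagram L.semilattice_monoid_axioms K.semilattice_monoid_axioms)
qed

text \<open>Naturality in the category of groups is an equation between extensional composites,
  hence a pointwise one. Arrows of diagrams are checked and taken apart in this form from here
  on.\<close>

lemma Hom_diagrams:
  assumes F: "group_diagram L F" and G: "group_diagram K G"
  shows "(t, \<alpha>) \<in> Hom diagrams (L, F) (K, G) \<longleftrightarrow>
    t \<in> monoid_homs L K \<and> \<alpha> \<in> extensional (carrier L) \<and>
    (\<forall>e\<in>carrier L. \<alpha> e \<in> monoid_homs (fobj F e) (fobj G (t e))) \<and>
    (\<forall>e\<in>carrier L. \<forall>m\<in>carrier L. m = m \<otimes>\<^bsub>L\<^esub> e \<longrightarrow> (\<forall>x\<in>carrier (fobj F e).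
      fmap G (t e) (t m) () (\<alpha> e x) = \<alpha> m (fmap F e m () x)))"
  unfolding Hom_diagrams_nat_trans[OF assms] nat_trans_def
  by (simp add: compose_eq_compose_iff Ball_def cong: conj_cong)

text \<open>Before it can follow \<alpha>, the transformation \<beta> is reindexed along
  \<open>t\<close>, which turns it into the family with value \<open>\<beta> (t e)\<close> at
  \<open>e\<close>.\<close>

lemma Comp_diagrams:
  assumes "group_diagram L F" "group_diagram K G" "group_diagram M H"
    and "(t, \<alpha>) \<in> Hom diagrams (L, F) (K, G)" "(s, \<beta>) \<in> Hom diagrams (K, G) (M, H)"
  shows "Comp diagrams (L, F) (K, G) (M, H) (s, \<beta>) (t, \<alpha>) =
    (compose (carrier L) s t, \<lambda>e\<in>carrier L. compose (carrier (fobj F e)) (\<beta> (t e)) (\<alpha> e))"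
proof -
  interpret L: group_diagram L F by fact
  interpret K: group_diagram K G by fact
  interpret M: group_diagram M H by fact
  have t: "t \<in> monoid_homs L K" and s: "s \<in> monoid_homs K M"
    and \<beta>: "\<beta> \<in> nat_trans (op_cat (poset_cat K)) Grp G
      (comp_ftor (op_cat (poset_cat K)) H (op_ftor (poset_ftor K s)))"
    using assms by (auto simp: Hom_diagrams_nat_trans)
  \<comment> \<open>The target of \<beta> must be recognised as an object of the functor category
    over \<open>K\<close> before the action of precomposition on \<beta> can be evaluated.\<close>
  have "is_functor (op_cat (poset_cat K)) Grp
    (comp_ftor (op_cat (poset_cat K)) H (op_ftor (poset_ftor K s)))"
    by (intro is_functor_comp_ftor[OF _ is_functor_op_poset_ftor M.is_diagram]
        category_op_cat category_poset_cat K.semilattice_monoid_axioms s)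
  with \<beta> t s show ?thesis
    by (auto simp: Grothendieck_def Cat_op_Grp_def Fun_cat_def
        K.is_diagram M.is_diagram L.semilattice_monoid_axioms K.semilattice_monoid_axioms
        M.semilattice_monoid_axioms SLat_def Mon_cat_def intro!: restrict_ext)
qed

lemma Ident_diagrams:
  assumes "group_diagram L F"
  shows "Ident diagrams (L, F) = (\<lambda>e\<in>carrier L. e, \<lambda>e\<in>carrier L. \<lambda>x\<in>carrier (fobj F e). x)"
  using assms
  by (simp add: Grothendieck_def Cat_op_Grp_def Fun_cat_def SLat_def Mon_cat_def
      group_diagram_def)

section \<open>Homomorphisms of total monoids and their correspondence with arrows of
  diagrams\<close>

definition total_hom :: "('a \<times> 'a \<Rightarrow> 'a) \<Rightarrow> 'a monoid
    \<Rightarrow> ('a, unit, 'a monoid, 'a \<Rightarrow> 'a) ftor \<Rightarrow> ('a \<Rightarrow> 'a) \<times> ('a \<Rightarrow> 'a \<Rightarrow> 'a) \<Rightarrow> 'a \<Rightarrow> 'a" where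
  "total_hom p L F = (\<lambda>(t, \<alpha>). \<lambda>z\<in>carrier (total_monoid p L F).
     let (e, x) = inv_into UNIV p z in p (t e, \<alpha> e x))"

definition total_ftor :: "('a \<times> 'a \<Rightarrow> 'a)
    \<Rightarrow> ('a diagram, ('a \<Rightarrow> 'a) \<times> ('a \<Rightarrow> 'a \<Rightarrow> 'a), 'a monoid, 'a \<Rightarrow> 'a) ftor" where
  "total_ftor p = mk_ftor diagrams (\<lambda>(L, F). total_monoid p L F)
     (\<lambda>(L, F) (K, G). total_hom p L F)"

locale encoding =
  fixes p :: "'a \<times> 'a \<Rightarrow> 'a"
  assumes inj_p: "inj p"
begin

lemma encoded: "group_diagram L F \<Longrightarrow> encoded_group_diagram L F p"
  by (simp add: encoded_group_diagram_def encoded_group_diagram_axioms_def inj_p)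

lemma total_hom_p:
  assumes "group_diagram L F" "e \<in> carrier L" "x \<in> carrier (fobj F e)"
  shows "total_hom p L F (t, \<alpha>) (p (e, x)) = p (t e, \<alpha> e x)"
proof -
  interpret encoded_group_diagram L F p by (rule encoded) fact
  show ?thesis using assms by (simp add: total_hom_def)
qed

text \<open>At the meet of the indices \<alpha> is multiplicative, and naturality moves it inside
  the two restrictions; on indices, \<open>t\<close> preserves meets.\<close>

lemma total_hom_in_homs:
  assumes F: "group_diagram L F" and G: "group_diagram K G"
    and a: "(t, \<alpha>) \<in> Hom diagrams (L, F) (K, G)"
  shows "total_hom p L F (t, \<alpha>) \<in> monoid_homs (total_monoid p L F) (total_monoid p K G)"
proof -
  interpret L: encoded_group_diagram L F p by (rule encoded) fact
  interpret K: encoded_group_diagram K G p by (rule encoded) fact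
  have t: "t e \<in> carrier K" "t (e \<otimes>\<^bsub>L\<^esub> f) = t e \<otimes>\<^bsub>K\<^esub> t f" "t \<one>\<^bsub>L\<^esub> = \<one>\<^bsub>K\<^esub>"
    if "e \<in> carrier L" "f \<in> carrier L" for e f
    using a that by (auto simp: Hom_diagrams[OF F G] monoid_homs_def hom_def)
  have \<alpha>: "\<alpha> e x \<in> carrier (fobj G (t e))" "\<alpha> e \<one>\<^bsub>fobj F e\<^esub> = \<one>\<^bsub>fobj G (t e)\<^esub>"
    "\<alpha> e (x \<otimes>\<^bsub>fobj F e\<^esub> y) = \<alpha> e x \<otimes>\<^bsub>fobj G (t e)\<^esub> \<alpha> e y"
    if "e \<in> carrier L" "x \<in> carrier (fobj F e)" "y \<in> carrier (fobj F e)" for e x y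
    using a that by (auto simp: Hom_diagrams[OF F G] monoid_homs_def hom_def)
  have \<alpha>_res: "K.res (t e) (t m) (\<alpha> e x) = \<alpha> m (L.res e m x)"
    if "e \<in> carrier L" "m \<in> carrier L" "m = m \<otimes>\<^bsub>L\<^esub> e" "x \<in> carrier (fobj F e)" for e m x
    using a that unfolding Hom_diagrams[OF F G] by blast
  let ?h = "total_hom p L F (t, \<alpha>)"
  have "?h (z \<otimes>\<^bsub>L.T\<^esub> w) = ?h z \<otimes>\<^bsub>K.T\<^esub> ?h w" if "z \<in> carrier L.T" "w \<in> carrier L.T" for z w
  proof -
    obtain e x where z: "z = p (e, x)" and e: "e \<in> carrier L" "x \<in> carrier (fobj F e)"
      using \<open>z \<in> carrier L.T\<close> by (rule L.total_cases)
    obtain f y where w: "w = p (f, y)" and f: "f \<in> carrier L" "y \<in> carrier (fobj F f)"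
      using \<open>w \<in> carrier L.T\<close> by (rule L.total_cases)
    let ?m = "e \<otimes>\<^bsub>L\<^esub> f"
    have m: "?m \<in> carrier L" "?m = ?m \<otimes>\<^bsub>L\<^esub> e" "?m = ?m \<otimes>\<^bsub>L\<^esub> f"
      using e f by (simp_all add: L.slat_simps)
    have r: "L.res e ?m x \<in> carrier (fobj F ?m)" "L.res f ?m y \<in> carrier (fobj F ?m)"
      using e f m by (auto intro: L.res_closed)
    interpret group "fobj F ?m" by (rule L.group_fobj) fact
    have "?h (z \<otimes>\<^bsub>L.T\<^esub> w) = p (t ?m, \<alpha> ?m (L.res e ?m x \<otimes>\<^bsub>fobj F ?m\<^esub> L.res f ?m y))"
      unfolding z w L.total_mult by (rule total_hom_p[OF F]) (use m r in auto)
    also have "\<dots> = ?h z \<otimes>\<^bsub>K.T\<^esub> ?h w"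
      using e f m r t(2)[of e f] \<alpha>_res[OF e(1) m(1,2) e(2)] \<alpha>_res[OF f(1) m(1,3) f(2)]
      by (simp add: z w total_hom_p[OF F] \<alpha>)
    finally show ?thesis .
  qed
  moreover have "?h z \<in> carrier K.T" if "z \<in> carrier L.T" for z
    using that by (elim L.total_cases) (simp add: total_hom_p[OF F] t \<alpha>)
  moreover have "?h \<one>\<^bsub>L.T\<^esub> = \<one>\<^bsub>K.T\<^esub>"
  proof -
    interpret group "fobj F \<one>\<^bsub>L\<^esub>" by (rule L.group_fobj) simp
    show ?thesis
      by (simp add: L.total_one K.total_one total_hom_p[OF F] t(3)[OF L.one_closed L.one_closed]
          \<alpha>(2)[OF L.one_closed one_closed one_closed])
  qed
  moreover have "?h \<in> extensional (carrier L.T)"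
    by (simp add: total_hom_def)
  ultimately show ?thesis
    by (simp add: monoid_homs_def hom_def)
qed

text \<open>The map on total monoids shows \<open>t e\<close> only through elements with index
  \<open>e\<close>. Every group contains its unit, so no index is missed.\<close>

lemma total_hom_faithful:
  assumes F: "group_diagram L F" and G: "group_diagram K G"
    and "(t, \<alpha>) \<in> Hom diagrams (L, F) (K, G)" "(s, \<beta>) \<in> Hom diagrams (L, F) (K, G)"
    and eq: "total_hom p L F (t, \<alpha>) = total_hom p L F (s, \<beta>)"
  shows "(t, \<alpha>) = (s, \<beta>)"
proof -
  interpret L: encoded_group_diagram L F p by (rule encoded) fact
  have *: "t e = s e" "\<alpha> e x = \<beta> e x" if "e \<in> carrier L" "x \<in> carrier (fobj F e)" for e x
    using fun_cong[OF eq, of "p (e, x)"] that by (simp_all add: total_hom_p[OF F])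
  have "t e = s e" if e: "e \<in> carrier L" for e
    using * e L.group_fobj[OF e] monoid.one_closed group.is_monoid by blast
  moreover have "\<alpha> e = \<beta> e" if e: "e \<in> carrier L" for e
    by (rule extensionalityI[of _ "carrier (fobj F e)"])
      (use assms(3,4) e * in \<open>auto simp: Hom_diagrams[OF F G] monoid_homs_def\<close>)
  ultimately show ?thesis
    using assms(3,4)
    by (auto simp: Hom_diagrams[OF F G] monoid_homs_def intro: extensionalityI[of _ "carrier L"])
qed

lemma total_hom_full:
  assumes F: "group_diagram L F" and G: "group_diagram K G"
    and h: "h \<in> monoid_homs (total_monoid p L F) (total_monoid p K G)"
  shows "\<exists>k\<in>Hom diagrams (L, F) (K, G). total_hom p L F k = h"
proof -
  interpret L: encoded_group_diagram L F p by (rule encoded) fact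
  interpret K: encoded_group_diagram K G p by (rule encoded) fact
  \<comment> \<open>A priori both components of the image depend on both \<open>e\<close> and
    \<open>x\<close>; only \<open>u_t\<close> removes \<open>x\<close> from the first.\<close>
  define u where "u e x = fst (inv_into UNIV p (h (p (e, x))))" for e x
  define v where "v e x = snd (inv_into UNIV p (h (p (e, x))))" for e x
  have h_T: "\<And>z. z \<in> carrier L.T \<Longrightarrow> h z \<in> carrier K.T"
    "\<And>z w. \<lbrakk>z \<in> carrier L.T; w \<in> carrier L.T\<rbrakk> \<Longrightarrow> h (z \<otimes>\<^bsub>L.T\<^esub> w) = h z \<otimes>\<^bsub>K.T\<^esub> h w"
    "h \<one>\<^bsub>L.T\<^esub> = \<one>\<^bsub>K.T\<^esub>"
    using h by (auto simp: monoid_homs_def hom_def)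
  have one: "\<one>\<^bsub>fobj F e\<^esub> \<in> carrier (fobj F e)" if "e \<in> carrier L" for e
    using L.group_fobj[OF that] by (simp add: group.is_monoid monoid.one_closed)
  have huv: "h (p (e, x)) = p (u e x, v e x)"
    and u: "u e x \<in> carrier K" and v: "v e x \<in> carrier (fobj G (u e x))"
    if "e \<in> carrier L" "x \<in> carrier (fobj F e)" for e x
  proof -
    have "h (p (e, x)) \<in> carrier K.T"
      using that by (intro h_T) auto
    then show "h (p (e, x)) = p (u e x, v e x)" "u e x \<in> carrier K" "v e x \<in> carrier (fobj G (u e x))"
      by (auto elim!: K.total_cases simp: u_def v_def)
  qed
  \<comment> \<open>The entry of the product is a variable \<open>z\<close> with a defining
    equation, so that simplified values can be supplied: a unit for \<open>t_mult\<close>, a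
    restriction for \<open>\<alpha>_res\<close>.\<close>
  have uv_mult: "u (e \<otimes>\<^bsub>L\<^esub> f) z = u e x \<otimes>\<^bsub>K\<^esub> u f y"
    "v (e \<otimes>\<^bsub>L\<^esub> f) z = K.res (u e x) (u e x \<otimes>\<^bsub>K\<^esub> u f y) (v e x)
       \<otimes>\<^bsub>fobj G (u e x \<otimes>\<^bsub>K\<^esub> u f y)\<^esub> K.res (u f y) (u e x \<otimes>\<^bsub>K\<^esub> u f y) (v f y)"
    if e: "e \<in> carrier L" "x \<in> carrier (fobj F e)" and f: "f \<in> carrier L" "y \<in> carrier (fobj F f)"
      and z: "z = L.res e (e \<otimes>\<^bsub>L\<^esub> f) x \<otimes>\<^bsub>fobj F (e \<otimes>\<^bsub>L\<^esub> f)\<^esub> L.res f (e \<otimes>\<^bsub>L\<^esub> f) y" for e x f y z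
  proof -
    have ef: "p (e \<otimes>\<^bsub>L\<^esub> f, z) = p (e, x) \<otimes>\<^bsub>L.T\<^esub> p (f, y)"
      by (simp add: z)
    then have "p (e \<otimes>\<^bsub>L\<^esub> f, z) \<in> carrier L.T"
      using e f monoid.m_closed[OF L.monoid_total, of "p (e, x)" "p (f, y)"] by simp
    then have "e \<otimes>\<^bsub>L\<^esub> f \<in> carrier L" "z \<in> carrier (fobj F (e \<otimes>\<^bsub>L\<^esub> f))"
      by simp_all
    then have "p (u (e \<otimes>\<^bsub>L\<^esub> f) z, v (e \<otimes>\<^bsub>L\<^esub> f) z) = p (u e x, v e x) \<otimes>\<^bsub>K.T\<^esub> p (u f y, v f y)"
      using h_T(2)[of "p (e, x)" "p (f, y)"] e f unfolding ef[symmetric]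
      by (simp add: huv del: K.total_mult)
    then show "u (e \<otimes>\<^bsub>L\<^esub> f) z = u e x \<otimes>\<^bsub>K\<^esub> u f y"
      "v (e \<otimes>\<^bsub>L\<^esub> f) z = K.res (u e x) (u e x \<otimes>\<^bsub>K\<^esub> u f y) (v e x)
       \<otimes>\<^bsub>fobj G (u e x \<otimes>\<^bsub>K\<^esub> u f y)\<^esub> K.res (u f y) (u e x \<otimes>\<^bsub>K\<^esub> u f y) (v f y)"
      by simp_all
  qed
  have u_same: "u e (x \<otimes>\<^bsub>fobj F e\<^esub> y) = u e x \<otimes>\<^bsub>K\<^esub> u e y"
    if "e \<in> carrier L" "x \<in> carrier (fobj F e)" "y \<in> carrier (fobj F e)" for e x y
    using uv_mult(1)[OF that(1,2,1,3) refl] that by (simp add: L.mult_idem L.res_id)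
  define t where "t = (\<lambda>e\<in>carrier L. u e \<one>\<^bsub>fobj F e\<^esub>)"
  have u_t: "u e x = t e" if e: "e \<in> carrier L" and x: "x \<in> carrier (fobj F e)" for e x
  proof -
    interpret E: group "fobj F e" by (rule L.group_fobj) fact
    let ?y = "inv\<^bsub>fobj F e\<^esub> x"
    \<comment> \<open>The unit is \<open>x\<close> times its inverse, so its index in
      \<open>K\<close> lies below \<open>u e x\<close>; \<open>x\<close> is \<open>x\<close> times
      the unit, which gives the reverse inequality.\<close>
    have 1: "u e \<one>\<^bsub>fobj F e\<^esub> = u e x \<otimes>\<^bsub>K\<^esub> u e ?y"
      using u_same[of e x ?y] e x by simp
    have "u e x = u e x \<otimes>\<^bsub>K\<^esub> u e \<one>\<^bsub>fobj F e\<^esub>"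
      using u_same[of e x "\<one>\<^bsub>fobj F e\<^esub>"] e x by simp
    also have "\<dots> = u e \<one>\<^bsub>fobj F e\<^esub>"
      unfolding 1 using e x by (simp add: u K.slat_simps)
    finally show ?thesis
      using e by (simp add: t_def)
  qed
  have t: "t e \<in> carrier K" if "e \<in> carrier L" for e
    using u[OF that one[OF that]] that by (simp add: t_def)
  have t_mult: "t (e \<otimes>\<^bsub>L\<^esub> f) = t e \<otimes>\<^bsub>K\<^esub> t f" if e: "e \<in> carrier L" and f: "f \<in> carrier L" for e f
  proof -
    interpret group "fobj F (e \<otimes>\<^bsub>L\<^esub> f)" by (rule L.group_fobj) (simp add: e f)
    \<comment> \<open>Units restrict to units, so the encoded units at \<open>e\<close> and
      \<open>f\<close> multiply to the one at the meet, and \<open>uv_mult\<close> can be read with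
      \<open>z\<close> a unit.\<close>
    have "L.res e (e \<otimes>\<^bsub>L\<^esub> f) \<one>\<^bsub>fobj F e\<^esub> \<otimes>\<^bsub>fobj F (e \<otimes>\<^bsub>L\<^esub> f)\<^esub> L.res f (e \<otimes>\<^bsub>L\<^esub> f) \<one>\<^bsub>fobj F f\<^esub>
        = \<one>\<^bsub>fobj F (e \<otimes>\<^bsub>L\<^esub> f)\<^esub>"
      using e f by (simp add: L.res_one L.slat_simps)
    from uv_mult(1)[OF e one[OF e] f one[OF f] this[symmetric]] show ?thesis
      using e f by (simp add: t_def)
  qed
  have t_hom: "t \<in> monoid_homs L K"
  proof -
    have "p (u \<one>\<^bsub>L\<^esub> \<one>\<^bsub>fobj F \<one>\<^bsub>L\<^esub>\<^esub>, v \<one>\<^bsub>L\<^esub> \<one>\<^bsub>fobj F \<one>\<^bsub>L\<^esub>\<^esub>) = \<one>\<^bsub>K.T\<^esub>"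
      using h_T(3) huv[OF L.one_closed one[OF L.one_closed]]
      by (simp add: L.monoid_total L.total_one)
    then have "t \<one>\<^bsub>L\<^esub> = \<one>\<^bsub>K\<^esub>"
      by (simp add: t_def K.total_one)
    then show ?thesis
      using t t_mult by (auto simp: monoid_homs_def hom_def t_def)
  qed
  define \<alpha> where "\<alpha> = (\<lambda>e\<in>carrier L. \<lambda>x\<in>carrier (fobj F e). v e x)"
  have \<alpha>: "\<alpha> e x \<in> carrier (fobj G (t e))" if "e \<in> carrier L" "x \<in> carrier (fobj F e)" for e x
    using v[OF that] u_t[OF that] that by (simp add: \<alpha>_def)
  have \<alpha>_mult: "\<alpha> e (x \<otimes>\<^bsub>fobj F e\<^esub> y) = \<alpha> e x \<otimes>\<^bsub>fobj G (t e)\<^esub> \<alpha> e y"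
    if e: "e \<in> carrier L" and x: "x \<in> carrier (fobj F e)" and y: "y \<in> carrier (fobj F e)" for e x y
  proof -
    interpret group "fobj F e" by (rule L.group_fobj) fact
    show ?thesis
      using uv_mult(2)[OF e x e y refl] e x y \<alpha>[OF e x] \<alpha>[OF e y] t[OF e]
      by (simp add: L.mult_idem L.res_id K.mult_idem K.res_id u_t \<alpha>_def)
  qed
  \<comment> \<open>Between groups multiplicativity already gives preservation of the unit, which is
    used as \<open>v_one\<close> in the proof of naturality.\<close>
  have \<alpha>_hom: "\<alpha> e \<in> monoid_homs (fobj F e) (fobj G (t e))" if e: "e \<in> carrier L" for e
    unfolding monoid_homs_group[OF L.group_fobj[OF e] K.group_fobj[OF t[OF e]]]
    using e \<alpha> \<alpha>_mult by (auto simp: hom_def) (simp add: \<alpha>_def)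
  have \<alpha>_res: "K.res (t e) (t m) (\<alpha> e x) = \<alpha> m (L.res e m x)"
    if e: "e \<in> carrier L" and m: "m \<in> carrier L" and me: "m = m \<otimes>\<^bsub>L\<^esub> e"
      and x: "x \<in> carrier (fobj F e)" for e m x
  proof -
    interpret M: group "fobj F m" by (rule L.group_fobj) fact
    interpret M': group "fobj G (t m)" by (rule K.group_fobj) (rule t[OF m])
    have r: "L.res e m x \<in> carrier (fobj F m)"
      using e m me x by (rule L.res_closed)
    have tm: "t m = t m \<otimes>\<^bsub>K\<^esub> t e"
      using t_mult[OF m e] me by simp
    have r': "K.res (t e) (t m) (\<alpha> e x) \<in> carrier (fobj G (t m))"
      using t[OF e] t[OF m] tm \<alpha>[OF e x] by (rule K.res_closed)
    have v_one: "v m \<one>\<^bsub>fobj F m\<^esub> = \<one>\<^bsub>fobj G (t m)\<^esub>"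
      using \<alpha>_hom[OF m] m by (simp add: monoid_homs_def \<alpha>_def)
    \<comment> \<open>This exhibits the restriction of \<open>x\<close> as the entry of the product
      of the unit at \<open>m\<close> with \<open>x\<close>. Applying \<open>uv_mult\<close> to that
      product gives naturality, since the unit at \<open>m\<close> is sent to a unit.\<close>
    have "L.res e m x = L.res m (m \<otimes>\<^bsub>L\<^esub> e) \<one>\<^bsub>fobj F m\<^esub>
        \<otimes>\<^bsub>fobj F (m \<otimes>\<^bsub>L\<^esub> e)\<^esub> L.res e (m \<otimes>\<^bsub>L\<^esub> e) x"
      using me[symmetric] m r by (simp add: L.res_id)
    from uv_mult(2)[OF m one[OF m] e x this] show ?thesis
      using me[symmetric] tm[symmetric] m e x r r' t[OF m]
      by (simp add: u_t v_one K.res_id \<alpha>_def)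
  qed
  have "(t, \<alpha>) \<in> Hom diagrams (L, F) (K, G)"
    unfolding Hom_diagrams[OF F G] using t_hom \<alpha>_hom \<alpha>_res by (auto simp: \<alpha>_def)
  moreover have "total_hom p L F (t, \<alpha>) = h"
  proof (rule extensionalityI[of _ "carrier L.T"])
    show "total_hom p L F (t, \<alpha>) z = h z" if "z \<in> carrier L.T" for z
      using that
      by (elim L.total_cases) (simp add: total_hom_p[OF F] huv u_t, simp add: \<alpha>_def)
  qed (use h in \<open>simp_all add: total_hom_def monoid_homs_def\<close>)
  ultimately show ?thesis
    by blast
qed

lemma is_functor_total_ftor: "is_functor diagrams Cliff (total_ftor p)"
  unfolding total_ftor_def
proof (rule is_functor_mk_ftor)
  show "category (diagrams :: ('a diagram, _) cat)"
    by (intro category_Grothendieck category_SLat is_functor_Cat_op_Grp)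
  fix X :: "'a diagram" assume "X \<in> Obj diagrams"
  moreover obtain L F where X: "X = (L, F)" by fastforce
  ultimately have F: "group_diagram L F" by simp
  interpret L: encoded_group_diagram L F p by (rule encoded) (rule F)
  show "(case X of (L, F) \<Rightarrow> total_monoid p L F) \<in> Obj Cliff"
    using L.clifford_total by (simp add: X Cliff_def Mon_cat_def)
  show "(case X of (L, F) \<Rightarrow> \<lambda>(K, G). total_hom p L F) X (Ident diagrams X) =
    Ident Cliff (case X of (L, F) \<Rightarrow> total_monoid p L F)"
  proof -
    have "total_hom p L F (Ident diagrams (L, F)) = (\<lambda>z\<in>carrier L.T. z)"
    proof (rule extensionalityI[of _ "carrier L.T"])
      show "total_hom p L F (Ident diagrams (L, F)) z = (\<lambda>z\<in>carrier L.T. z) z"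
        if "z \<in> carrier L.T" for z
        using that
        by (elim L.total_cases) (simp add: Ident_diagrams[OF F] total_hom_p[OF F])
    qed (simp_all add: total_hom_def split_beta)
    then show ?thesis
      by (simp add: X Cliff_def Mon_cat_def)
  qed
  fix Y :: "'a diagram" and a assume Y: "Y \<in> Obj diagrams" "a \<in> Hom diagrams X Y"
  moreover obtain K G where YKG: "Y = (K, G)" by fastforce
  ultimately have G: "group_diagram K G" by simp
  obtain t \<alpha> where a: "a = (t, \<alpha>)" by fastforce
  have ta: "(t, \<alpha>) \<in> Hom diagrams (L, F) (K, G)" using Y by (simp add: X YKG a)
  show "(case X of (L, F) \<Rightarrow> \<lambda>(K, G). total_hom p L F) Y a
    \<in> Hom Cliff (case X of (L, F) \<Rightarrow> total_monoid p L F) (case Y of (L, F) \<Rightarrow> total_monoid p L F)"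
    using total_hom_in_homs[OF F G ta] by (simp add: X YKG a Cliff_def Mon_cat_def)
  fix Z :: "'a diagram" and b assume Z: "Z \<in> Obj diagrams" "b \<in> Hom diagrams Y Z"
  moreover obtain M H where ZMH: "Z = (M, H)" by fastforce
  ultimately have H: "group_diagram M H" by simp
  obtain s \<beta> where b: "b = (s, \<beta>)" by fastforce
  have sb: "(s, \<beta>) \<in> Hom diagrams (K, G) (M, H)" using Z by (simp add: ZMH YKG b)
  have "total_hom p L F (Comp diagrams (L, F) (K, G) (M, H) (s, \<beta>) (t, \<alpha>)) =
    compose (carrier L.T) (total_hom p K G (s, \<beta>)) (total_hom p L F (t, \<alpha>))" (is "?l = ?r")
  proof (rule extensionalityI[of _ "carrier L.T"])
    fix z assume "z \<in> carrier L.T"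
    then obtain e x where z: "z = p (e, x)" and e: "e \<in> carrier L" "x \<in> carrier (fobj F e)"
      by (rule L.total_cases)
    have "t e \<in> carrier K" "\<alpha> e x \<in> carrier (fobj G (t e))"
      using ta e by (auto simp: Hom_diagrams[OF F G] monoid_homs_def hom_def)
    then show "?l z = ?r z"
      using e by (simp add: z Comp_diagrams[OF F G H ta sb] total_hom_p[OF F] total_hom_p[OF G]
          compose_def)
  qed (simp_all add: total_hom_def split_beta)
  then show "(case X of (L, F) \<Rightarrow> \<lambda>(K, G). total_hom p L F) Z (Comp diagrams X Y Z b a) =
    Comp Cliff (case X of (L, F) \<Rightarrow> total_monoid p L F) (case Y of (L, F) \<Rightarrow> total_monoid p L F)
      (case Z of (L, F) \<Rightarrow> total_monoid p L F)
      ((case Y of (L, F) \<Rightarrow> \<lambda>(K, G). total_hom p L F) Z b)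
      ((case X of (L, F) \<Rightarrow> \<lambda>(K, G). total_hom p L F) Y a)"
    by (simp add: X YKG ZMH a b Cliff_def Mon_cat_def)
qed

end

section \<open>The diagram of groups of a Clifford monoid\<close>

context clifford_monoid
begin

section \<open>Inverses and supports in a Clifford monoid\<close>

definition star :: "'a \<Rightarrow> 'a" where
  "star x = (THE y. y \<in> carrier M \<and> x \<otimes> y \<otimes> x = x \<and> y \<otimes> x \<otimes> y = y)"

lemma
  assumes "x \<in> carrier M"
  shows star_closed: "star x \<in> carrier M"
    and mult_star_mult: "x \<otimes> star x \<otimes> x = x"
    and star_mult_star: "star x \<otimes> x \<otimes> star x = star x"
  using theI'[OF ex1_inverse[OF assms]] by (simp_all add: star_def)

lemma star_eqI:
  "\<lbrakk>x \<in> carrier M; y \<in> carrier M; x \<otimes> y \<otimes> x = x; y \<otimes> x \<otimes> y = y\<rbrakk> \<Longrightarrow> star x = y"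
  unfolding star_def by (rule the1_equality[OF ex1_inverse]) simp_all

text \<open>The unit of the group to which \<open>x\<close> will belong, hence the index of
  \<open>x\<close> in Clifford's decomposition.\<close>

definition supp :: "'a \<Rightarrow> 'a" where
  "supp x = x \<otimes> star x"

lemma supp_closed: "x \<in> carrier M \<Longrightarrow> supp x \<in> carrier M"
  by (simp add: supp_def star_closed)

lemma supp_idem: "x \<in> carrier M \<Longrightarrow> supp x \<otimes> supp x = supp x"
  by (metis m_assoc m_closed mult_star_mult star_closed supp_def)

lemma supp_mult: "x \<in> carrier M \<Longrightarrow> supp x \<otimes> x = x"
  by (simp add: supp_def mult_star_mult)

lemma supp_central: "\<lbrakk>x \<in> carrier M; y \<in> carrier M\<rbrakk> \<Longrightarrow> supp x \<otimes> y = y \<otimes> supp x"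
  by (simp add: idem_central supp_closed supp_idem)

lemma star_mult_idem: "x \<in> carrier M \<Longrightarrow> (star x \<otimes> x) \<otimes> (star x \<otimes> x) = star x \<otimes> x"
  by (metis m_assoc m_closed star_closed star_mult_star)

text \<open>Both \<open>x x\<^sup>*\<close> and \<open>x\<^sup>* x\<close> are central idempotents, so each of them absorbs the other.\<close>

lemma star_mult:
  assumes x: "x \<in> carrier M"
  shows "star x \<otimes> x = supp x"
proof -
  let ?f = "star x \<otimes> x"
  have f: "?f \<in> carrier M" "?f \<otimes> y = y \<otimes> ?f" if "y \<in> carrier M" for y
    using x that by (simp_all add: star_closed idem_central star_mult_idem)
  have "?f = star x \<otimes> (supp x \<otimes> x)"
    using x by (simp add: supp_mult)
  also have "\<dots> = supp x \<otimes> ?f"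
    using x supp_central[OF x star_closed[OF x]]
    by (simp add: m_assoc[symmetric] star_closed supp_closed)
  also have "\<dots> = ?f \<otimes> x \<otimes> star x"
    using x f by (simp add: supp_def m_assoc star_closed)
  also have "\<dots> = x \<otimes> ?f \<otimes> star x"
    using f(2)[OF x] by simp
  also have "\<dots> = supp x"
    using x by (simp add: m_assoc[symmetric] star_closed mult_star_mult supp_def)
  finally show ?thesis .
qed

lemma idem_mult_idem:
  assumes "e \<in> carrier M" "e \<otimes> e = e" "f \<in> carrier M" "f \<otimes> f = f"
  shows "(e \<otimes> f) \<otimes> (e \<otimes> f) = e \<otimes> f"
proof -
  have "(e \<otimes> f) \<otimes> (e \<otimes> f) = e \<otimes> (f \<otimes> e) \<otimes> f"
    using assms by (simp add: m_assoc)
  also have "f \<otimes> e = e \<otimes> f"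
    using assms by (simp add: idem_central)
  also have "e \<otimes> (e \<otimes> f) \<otimes> f = (e \<otimes> e) \<otimes> (f \<otimes> f)"
    using assms(1,3) by (simp add: m_assoc)
  finally show ?thesis
    using assms by simp
qed

lemma idem_mult_absorb:
  assumes "e \<in> carrier M" "e \<otimes> e = e" "f \<in> carrier M" "f \<otimes> f = f"
  shows "e \<otimes> f \<otimes> e = e \<otimes> f" "e \<otimes> f \<otimes> f = e \<otimes> f"
proof -
  have "e \<otimes> f \<otimes> e = e \<otimes> (e \<otimes> f)"
    using m_assoc[of e f e] idem_central[of e f] assms by simp
  also have "\<dots> = e \<otimes> f"
    using m_assoc[of e e f] assms by simp
  finally show "e \<otimes> f \<otimes> e = e \<otimes> f" .
  show "e \<otimes> f \<otimes> f = e \<otimes> f"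
    using m_assoc[of e f f] assms by simp
qed

text \<open>Centrality brings the two copies of \<open>e\<close> together, where they merge. This is
  why the restriction maps, which multiply by an idempotent, are homomorphisms.\<close>

lemma idem_distrib:
  assumes e: "e \<in> carrier M" "e \<otimes> e = e" and x: "x \<in> carrier M" and y: "y \<in> carrier M"
  shows "e \<otimes> x \<otimes> (e \<otimes> y) = e \<otimes> (x \<otimes> y)"
proof -
  have "e \<otimes> x \<otimes> (e \<otimes> y) = e \<otimes> (x \<otimes> e) \<otimes> y"
    using e(1) x y by (simp add: m_assoc)
  also have "x \<otimes> e = e \<otimes> x"
    by (rule idem_central[symmetric, OF e x])
  finally show ?thesis
    using e x y by (simp add: m_assoc[symmetric])
qed

text \<open>Here \<open>y\<close> is the inverse of \<open>x\<close>: x y x = e x = x, and y x y = y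
  e = e y = y by centrality. Supports can thus be recognised without computing
  \<open>star\<close>.\<close>

lemma supp_eqI:
  assumes "e \<in> carrier M" "e \<otimes> e = e" and x: "x \<in> carrier M" and "e \<otimes> x = x"
    and y: "y \<in> carrier M" and xy: "x \<otimes> y = e" and "e \<otimes> y = y"
  shows "supp x = e"
proof -
  have "y \<otimes> x \<otimes> y = y \<otimes> e"
    using x y xy by (simp add: m_assoc)
  also have "\<dots> = e \<otimes> y"
    by (rule idem_central[symmetric]) fact+
  finally have "star x = y"
    using assms by (intro star_eqI) simp_all
  then show ?thesis
    using xy by (simp add: supp_def)
qed

lemma supp_of_idem:
  assumes "e \<in> carrier M" "e \<otimes> e = e"
  shows "supp e = e"
  using supp_eqI[of e e e] assms by simp

text \<open>An instance of \<open>supp_eqI\<close> with \<open>star y \<otimes> star x\<close> as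
  the inverse of the product; central supports move out of the way in each of its conditions.
  Consequently products stay within a component, and multiplying by an idempotent changes the index
  to the meet.\<close>

lemma supp_of_mult:
  assumes x: "x \<in> carrier M" and y: "y \<in> carrier M"
  shows "supp (x \<otimes> y) = supp x \<otimes> supp y"
proof -
  note c = x y star_closed supp_closed
  have xy: "supp x \<otimes> supp y \<otimes> (x \<otimes> y) = x \<otimes> y"
  proof -
    have "supp x \<otimes> supp y \<otimes> (x \<otimes> y) = supp x \<otimes> (supp y \<otimes> x) \<otimes> y"
      using c by (simp add: m_assoc)
    also have "\<dots> = (supp x \<otimes> x) \<otimes> (supp y \<otimes> y)"
      using c by (simp add: m_assoc supp_central[OF y x])
    finally show ?thesis
      using x y by (simp add: supp_mult)
  qed
  have ss: "supp x \<otimes> supp y \<otimes> (star y \<otimes> star x) = star y \<otimes> star x"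
  proof -
    have sx: "supp x \<otimes> star x = star x" if "x \<in> carrier M" for x
      using star_mult_star[OF that] star_mult[OF that] by simp
    have "supp x \<otimes> supp y \<otimes> (star y \<otimes> star x) = supp x \<otimes> (supp y \<otimes> star y) \<otimes> star x"
      using c by (simp add: m_assoc)
    also have "\<dots> = supp x \<otimes> star y \<otimes> star x"
      using y by (simp add: sx)
    also have "\<dots> = star y \<otimes> (supp x \<otimes> star x)"
      using c supp_central[OF x star_closed[OF y]] by (simp add: m_assoc)
    finally show ?thesis
      using x by (simp add: sx)
  qed
  have "x \<otimes> y \<otimes> (star y \<otimes> star x) = x \<otimes> supp y \<otimes> star x"
    using c by (simp add: m_assoc supp_def)
  also have "\<dots> = supp y \<otimes> x \<otimes> star x"
    by (simp only: supp_central[OF y x])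
  also have "\<dots> = supp y \<otimes> supp x"
    using c by (simp add: m_assoc supp_def)
  also have "\<dots> = supp x \<otimes> supp y"
    by (rule supp_central[OF y supp_closed[OF x]])
  finally have p: "x \<otimes> y \<otimes> (star y \<otimes> star x) = supp x \<otimes> supp y" .
  have i: "(supp x \<otimes> supp y) \<otimes> (supp x \<otimes> supp y) = supp x \<otimes> supp y"
    using x y by (intro idem_mult_idem supp_idem supp_closed)
  show ?thesis
    by (rule supp_eqI[OF _ i _ xy _ p ss]) (simp_all add: c)
qed

lemma star_star: "x \<in> carrier M \<Longrightarrow> star (star x) = x"
  by (rule star_eqI) (simp_all add: star_closed star_mult_star mult_star_mult)

lemma supp_star: "x \<in> carrier M \<Longrightarrow> supp (star x) = supp x"
  by (simp add: supp_def[of "star x"] star_star star_mult)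

section \<open>The semilattice of idempotents, the group components and their restriction
  maps\<close>

definition idempotents :: "'a monoid" where
  "idempotents = \<lparr>carrier = {e \<in> carrier M. e \<otimes> e = e}, mult = mult M, one = \<one>\<rparr>"

lemma idempotents_simps [simp]:
  "e \<in> carrier idempotents \<longleftrightarrow> e \<in> carrier M \<and> e \<otimes> e = e"
  "mult idempotents = mult M" "\<one>\<^bsub>idempotents\<^esub> = \<one>"
  by (simp_all add: idempotents_def)

lemma semilattice_idempotents: "semilattice_monoid idempotents"
proof (intro semilattice_monoid.intro comm_monoidI semilattice_monoid_axioms.intro)
  show "x \<otimes>\<^bsub>idempotents\<^esub> y \<in> carrier idempotents"
    if "x \<in> carrier idempotents" "y \<in> carrier idempotents" for x y
    using that by (simp add: idem_mult_idem)
  show "x \<otimes>\<^bsub>idempotents\<^esub> y \<otimes>\<^bsub>idempotents\<^esub> z = x \<otimes>\<^bsub>idempotents\<^esub> (y \<otimes>\<^bsub>idempotents\<^esub> z)"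
    if "x \<in> carrier idempotents" "y \<in> carrier idempotents" "z \<in> carrier idempotents" for x y z
    using that by (simp add: m_assoc)
  show "x \<otimes>\<^bsub>idempotents\<^esub> y = y \<otimes>\<^bsub>idempotents\<^esub> x"
    if "x \<in> carrier idempotents" "y \<in> carrier idempotents" for x y
    using that by (simp add: idem_central)
qed simp_all

definition component :: "'a \<Rightarrow> 'a monoid" where
  "component e = \<lparr>carrier = {x \<in> carrier M. supp x = e}, mult = mult M, one = e\<rparr>"

lemma component_simps [simp]:
  "x \<in> carrier (component e) \<longleftrightarrow> x \<in> carrier M \<and> supp x = e"
  "mult (component e) = mult M" "\<one>\<^bsub>component e\<^esub> = e"
  by (simp_all add: component_def)

text \<open>Closure is \<open>supp_of_mult\<close> with \<open>e\<close> idempotent. The inverse of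
  \<open>x\<close> is \<open>star x\<close>, which has the same support and satisfies
  \<open>star x \<otimes> x = supp x\<close>.\<close>

lemma group_component:
  assumes "e \<in> carrier M" "e \<otimes> e = e"
  shows "group (component e)"
proof (rule groupI)
  fix x y z
  assume x: "x \<in> carrier (component e)" and y: "y \<in> carrier (component e)"
    and z: "z \<in> carrier (component e)"
  show "x \<otimes>\<^bsub>component e\<^esub> y \<in> carrier (component e)"
    using x y assms by (simp add: supp_of_mult)
  show "x \<otimes>\<^bsub>component e\<^esub> y \<otimes>\<^bsub>component e\<^esub> z = x \<otimes>\<^bsub>component e\<^esub> (y \<otimes>\<^bsub>component e\<^esub> z)"
    using x y z by (simp add: m_assoc)
  show "\<one>\<^bsub>component e\<^esub> \<otimes>\<^bsub>component e\<^esub> x = x"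
    using x supp_mult[of x] by simp
  show "\<exists>y\<in>carrier (component e). y \<otimes>\<^bsub>component e\<^esub> x = \<one>\<^bsub>component e\<^esub>"
    using x by (intro bexI[of _ "star x"]) (simp_all add: star_closed supp_star star_mult)
next
  show "\<one>\<^bsub>component e\<^esub> \<in> carrier (component e)"
    using assms supp_of_idem by simp
qed

definition diagram :: "('a, unit, 'a monoid, 'a \<Rightarrow> 'a) ftor" where
  "diagram = mk_ftor (op_cat (poset_cat idempotents)) component
     (\<lambda>e m _. \<lambda>x\<in>carrier (component e). m \<otimes> x)"

text \<open>For m \<le> e and \<open>x\<close> with support \<open>e\<close>, the support of m x is
  m e = m, so multiplication by \<open>m\<close> lands in the right group;
  \<open>idem_distrib\<close> makes it multiplicative. Restrictions compose because n m = n whenever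
  n \<le> m.\<close>

lemma group_diagram_diagram: "group_diagram idempotents diagram"
proof (intro group_diagram.intro group_diagram_axioms.intro semilattice_idempotents)
  show "is_functor (op_cat (poset_cat idempotents)) Grp diagram"
    unfolding diagram_def
  proof (rule is_functor_mk_ftor)
    show "category (op_cat (poset_cat idempotents))"
      by (intro category_op_cat category_poset_cat semilattice_idempotents)
    show "component e \<in> Obj Grp" if "e \<in> Obj (op_cat (poset_cat idempotents))" for e
      using that by (simp add: group_component)
  next
    fix e m u
    assume "e \<in> Obj (op_cat (poset_cat idempotents))" "m \<in> Obj (op_cat (poset_cat idempotents))"
      "u \<in> Hom (op_cat (poset_cat idempotents)) e m"
    then have e: "e \<in> carrier M" "e \<otimes> e = e" and m: "m \<in> carrier M" "m \<otimes> m = m"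
      and me: "m \<otimes> e = m" by auto
    have "m \<otimes> (x \<otimes> y) = m \<otimes> x \<otimes> (m \<otimes> y)" if "x \<in> carrier M" "y \<in> carrier M" for x y
      using idem_distrib[OF m that] by simp
    moreover have "supp (m \<otimes> x) = m" if "x \<in> carrier M" "supp x = e" for x
      using m me that by (simp add: supp_of_mult supp_of_idem)
    moreover have "supp (x \<otimes> y) = e"
      if "x \<in> carrier M" "supp x = e" "y \<in> carrier M" "supp y = e" for x y
      using e that supp_of_mult[of x y] by simp
    ultimately have "(\<lambda>x\<in>carrier (component e). m \<otimes> x) \<in> hom (component e) (component m)"
      using m by (simp add: hom_def)
    then show "(\<lambda>x\<in>carrier (component e). m \<otimes> x) \<in> Hom Grp (component e) (component m)"
      using monoid_homs_group[OF group_component[OF e] group_component[OF m]] by simp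
  next
    fix e assume "e \<in> Obj (op_cat (poset_cat idempotents))"
    then show "(\<lambda>x\<in>carrier (component e). e \<otimes> x) = Ident Grp (component e)"
      by (auto simp: supp_mult intro!: restrict_ext)
  next
    fix e m n u v
    assume "e \<in> Obj (op_cat (poset_cat idempotents))" "m \<in> Obj (op_cat (poset_cat idempotents))"
      "n \<in> Obj (op_cat (poset_cat idempotents))"
      "u \<in> Hom (op_cat (poset_cat idempotents)) e m" "v \<in> Hom (op_cat (poset_cat idempotents)) m n"
    then have e: "e \<in> carrier M" "e \<otimes> e = e" and m: "m \<in> carrier M" "m \<otimes> m = m"
      and n: "n \<in> carrier M" and me: "m \<otimes> e = m" and nm: "n \<otimes> m = n" by auto
    have "n \<otimes> (m \<otimes> x) = n \<otimes> x" if "x \<in> carrier M" for x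
      using m_assoc[OF n m(1) that] nm by simp
    moreover have "supp (m \<otimes> x) = m" if "x \<in> carrier M" "supp x = e" for x
      using m me that by (simp add: supp_of_mult supp_of_idem)
    ultimately show "(\<lambda>x\<in>carrier (component e). n \<otimes> x) =
      Comp Grp (component e) (component m) (component n)
        (\<lambda>x\<in>carrier (component m). n \<otimes> x) (\<lambda>x\<in>carrier (component e). m \<otimes> x)"
      using m by (simp add: compose_def cong: restrict_cong)
  qed
qed

lemma fobj_diagram [simp]: "\<lbrakk>e \<in> carrier M; e \<otimes> e = e\<rbrakk> \<Longrightarrow> fobj diagram e = component e"
  unfolding diagram_def by (rule fobj_mk_ftor) simp

lemma fmap_diagram [simp]:
  assumes "e \<in> carrier M" "e \<otimes> e = e" "m \<in> carrier M" "m \<otimes> m = m" "m \<otimes> e = m"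
    and "x \<in> carrier M" "supp x = e"
  shows "fmap diagram e m u x = m \<otimes> x"
proof -
  have "fmap diagram e m u = (\<lambda>x\<in>carrier (component e). m \<otimes> x)"
    unfolding diagram_def using assms by (intro fmap_mk_ftor) simp_all
  then show ?thesis using assms by simp
qed
end

text \<open>The inverse of a bijective homomorphism is again a homomorphism; it is restricted to the
  carrier of \<open>H\<close> because arrows must be extensional.\<close>

lemma is_iso_Mon_cat:
  assumes "G \<in> \<M>" "H \<in> \<M>" "monoid G" and h: "h \<in> monoid_homs G H"
    and bij: "bij_betw h (carrier G) (carrier H)"
  shows "is_iso (Mon_cat \<M>) G H h"
proof -
  interpret G: Group.monoid G by fact
  let ?g = "restrict (inv_into (carrier G) h) (carrier H)"
  have gh: "?g (h x) = x" if "x \<in> carrier G" for x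
    using that bij by (simp add: bij_betw_inv_into_left bij_betwE)
  have hg: "h (?g y) = y" "?g y \<in> carrier G" if "y \<in> carrier H" for y
    using that bij by (simp_all add: bij_betw_inv_into_right bij_betwE[OF bij_betw_inv_into[OF bij]])
  have hom: "h x \<in> carrier H" "h (x \<otimes>\<^bsub>G\<^esub> y) = h x \<otimes>\<^bsub>H\<^esub> h y" "h \<one>\<^bsub>G\<^esub> = \<one>\<^bsub>H\<^esub>"
    if "x \<in> carrier G" "y \<in> carrier G" for x y
    using h that by (auto simp: monoid_homs_def hom_def)
  have "?g (x \<otimes>\<^bsub>H\<^esub> y) = ?g x \<otimes>\<^bsub>G\<^esub> ?g y" if "x \<in> carrier H" "y \<in> carrier H" for x y
    using gh[of "?g x \<otimes>\<^bsub>G\<^esub> ?g y"] hom(2)[of "?g x" "?g y"] hg that by (simp del: restrict_apply)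
  moreover have "?g \<one>\<^bsub>H\<^esub> = \<one>\<^bsub>G\<^esub>"
    using gh[of "\<one>\<^bsub>G\<^esub>"] hom(3)[OF G.one_closed G.one_closed] by (simp del: restrict_apply)
  ultimately have "?g \<in> monoid_homs H G"
    using hg(2) by (auto simp: monoid_homs_def hom_def simp del: restrict_apply)
  moreover have "compose (carrier G) ?g h = (\<lambda>x\<in>carrier G. x)"
    unfolding compose_def by (rule restrict_ext) (rule gh)
  moreover have "compose (carrier H) h ?g = (\<lambda>x\<in>carrier H. x)"
    unfolding compose_def by (rule restrict_ext) (rule hg(1))
  ultimately show ?thesis
    using h unfolding is_iso_def by (intro conjI bexI[of _ ?g]) (simp_all add: Mon_cat_def)
qed

section \<open>Essential surjectivity and the equivalence\<close>

context encoding
begin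

lemma total_ftor_ess_surj:
  assumes "clifford_monoid M"
  shows "\<exists>X\<in>Obj diagrams. \<exists>h. is_iso Cliff (fobj (total_ftor p) X) M h"
proof -
  interpret M: clifford_monoid M by fact
  note D = M.group_diagram_diagram
  interpret E: encoded_group_diagram M.idempotents M.diagram p
    by (rule encoded) (rule D)
  \<comment> \<open>The entry determines its index, since an element of the group at
    \<open>e\<close> has support \<open>e\<close>. So forgetting the index is inverted by pairing
    \<open>x\<close> with \<open>supp x\<close>.\<close>
  have cases: "\<exists>x\<in>carrier M. z = p (M.supp x, x)" if "z \<in> carrier E.T" for z
    using that by (elim E.total_cases) auto
  have mem: "p (M.supp x, x) \<in> carrier E.T" if "x \<in> carrier M" for x
    using that by (simp add: M.supp_closed M.supp_idem)
  define h where "h = (\<lambda>z\<in>carrier E.T. snd (inv_into UNIV p z))"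
  have h: "h (p (M.supp x, x)) = x" if "x \<in> carrier M" for x
    using mem[OF that] by (simp add: h_def del: E.p_in_carrier)
  have mult: "p (M.supp x, x) \<otimes>\<^bsub>E.T\<^esub> p (M.supp y, y) = p (M.supp (x \<otimes>\<^bsub>M\<^esub> y), x \<otimes>\<^bsub>M\<^esub> y)"
    if x: "x \<in> carrier M" and y: "y \<in> carrier M" for x y
  proof -
    let ?m = "M.supp x \<otimes>\<^bsub>M\<^esub> M.supp y"
    have m: "?m \<in> carrier M" "?m \<otimes>\<^bsub>M\<^esub> ?m = ?m"
      using x y by (auto intro!: M.m_closed M.supp_closed M.supp_idem M.idem_mult_idem)
    have m': "?m \<otimes>\<^bsub>M\<^esub> M.supp x = ?m" "?m \<otimes>\<^bsub>M\<^esub> M.supp y = ?m"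
      using M.idem_mult_absorb[OF M.supp_closed[OF x] M.supp_idem[OF x] M.supp_closed[OF y]
          M.supp_idem[OF y]] .
    \<comment> \<open>The product in the total monoid first multiplies both factors by
      \<open>?m\<close>. As \<open>?m\<close> is the support of the product of \<open>x\<close> and
      \<open>y\<close>, it is absorbed and the original product reappears.\<close>
    have "(?m \<otimes>\<^bsub>M\<^esub> x) \<otimes>\<^bsub>M\<^esub> (?m \<otimes>\<^bsub>M\<^esub> y) = ?m \<otimes>\<^bsub>M\<^esub> (x \<otimes>\<^bsub>M\<^esub> y)"
      by (rule M.idem_distrib[OF m x y])
    also have "\<dots> = x \<otimes>\<^bsub>M\<^esub> y"
      using M.supp_mult[of "x \<otimes>\<^bsub>M\<^esub> y"] x y by (simp add: M.supp_of_mult)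
    finally have xy: "(?m \<otimes>\<^bsub>M\<^esub> x) \<otimes>\<^bsub>M\<^esub> (?m \<otimes>\<^bsub>M\<^esub> y) = x \<otimes>\<^bsub>M\<^esub> y" .
    have fm: "fmap M.diagram (M.supp x) ?m () x = ?m \<otimes>\<^bsub>M\<^esub> x"
      "fmap M.diagram (M.supp y) ?m () y = ?m \<otimes>\<^bsub>M\<^esub> y"
      using x y m m' by (auto intro!: M.fmap_diagram M.supp_closed M.supp_idem)
    show ?thesis
      unfolding E.total_mult M.idempotents_simps fm M.fobj_diagram[OF m] M.component_simps xy
        M.supp_of_mult[OF x y] ..
  qed
  have one: "\<one>\<^bsub>E.T\<^esub> = p (M.supp \<one>\<^bsub>M\<^esub>, \<one>\<^bsub>M\<^esub>)"
    by (simp add: E.total_one M.supp_of_idem)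
  have h_closed: "h z \<in> carrier M" and p_h: "p (M.supp (h z), h z) = z" if "z \<in> carrier E.T" for z
    using cases[OF that] h by auto
  have "h (z \<otimes>\<^bsub>E.T\<^esub> w) = h z \<otimes>\<^bsub>M\<^esub> h w" if "z \<in> carrier E.T" "w \<in> carrier E.T" for z w
    using cases[OF that(1)] cases[OF that(2)] by (auto simp: mult h simp del: E.total_mult)
  then have "h \<in> monoid_homs E.T M"
    using h_closed by (auto simp: monoid_homs_def hom_def one h) (simp add: h_def)
  moreover have "bij_betw h (carrier E.T) (carrier M)"
    by (rule bij_betw_byWitness[where f' = "\<lambda>x. p (M.supp x, x)"])
      (use h_closed p_h mem h in \<open>auto simp del: E.p_in_carrier\<close>)
  ultimately have "is_iso Cliff E.T M h"
    unfolding Cliff_def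
    by (intro is_iso_Mon_cat) (simp_all add: E.clifford_total E.monoid_total assms)
  then show ?thesis
    using D by (intro bexI[of _ "(M.idempotents, M.diagram)"]) (auto simp: total_ftor_def)
qed

lemma equivalent_diagrams_Cliff:
  "equivalent_cats (diagrams :: ('a diagram, _) cat) (Cliff :: ('a monoid, _) cat)"
proof (rule equivalent_catsI[where F = "total_ftor p"])
  show "category (diagrams :: ('a diagram, _) cat)"
    by (intro category_Grothendieck category_SLat is_functor_Cat_op_Grp)
  show "category (Cliff :: ('a monoid, _) cat)"
    by (rule category_Cliff)
  show "is_functor diagrams Cliff (total_ftor p)"
    by (rule is_functor_total_ftor)
  show "\<exists>X\<in>Obj diagrams. \<exists>e. is_iso Cliff (fobj (total_ftor p) X) M e" if "M \<in> Obj Cliff" for M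
    using that by (intro total_ftor_ess_surj) (simp add: Cliff_def Mon_cat_def)
next
  fix X Y :: "'a diagram" and g
  assume "X \<in> Obj diagrams" "Y \<in> Obj diagrams"
    and "g \<in> Hom Cliff (fobj (total_ftor p) X) (fobj (total_ftor p) Y)"
  moreover obtain L F K G where "X = (L, F)" "Y = (K, G)" by fastforce
  ultimately show "\<exists>f\<in>Hom diagrams X Y. fmap (total_ftor p) X Y f = g"
    using total_hom_full[of L F K G g] by (auto simp: total_ftor_def Cliff_def Mon_cat_def)
next
  fix X Y :: "'a diagram" and f f'
  assume "X \<in> Obj diagrams" "Y \<in> Obj diagrams" "f \<in> Hom diagrams X Y" "f' \<in> Hom diagrams X Y"
    "fmap (total_ftor p) X Y f = fmap (total_ftor p) X Y f'"
  moreover obtain L F K G where "X = (L, F)" "Y = (K, G)" by fastforce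
  moreover obtain t \<alpha> s \<beta> where "f = (t, \<alpha>)" "f' = (s, \<beta>)" by fastforce
  ultimately show "f = f'"
    using total_hom_faithful[of L F K G t \<alpha> s \<beta>] by (simp add: total_ftor_def)
qed

end

theorem theorem5p5:
  assumes "infinite (UNIV :: 'a set)"
  shows "is_functor (op_cat (SLat :: ('a monoid, 'a \<Rightarrow> 'a) cat)) Cat Cat_op_Grp \<and>
         equivalent_cats
           (Grothendieck (SLat :: ('a monoid, 'a \<Rightarrow> 'a) cat) Cat_op_Grp)
           (Cliff :: ('a monoid, 'a \<Rightarrow> 'a) cat)"
proof
  \<comment> \<open>The square of an infinite type has the cardinality of the type itself.\<close>
  obtain p :: "'a \<times> 'a \<Rightarrow> 'a" where "inj p"
    using card_of_Times_same_infinite[OF assms]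
    by (auto simp: card_of_ordIso[symmetric] bij_betw_def)
  then interpret encoding p by unfold_locales
  show "equivalent_cats
      (Grothendieck (SLat :: ('a monoid, 'a \<Rightarrow> 'a) cat) Cat_op_Grp)
      (Cliff :: ('a monoid, 'a \<Rightarrow> 'a) cat)"
    by (rule equivalent_diagrams_Cliff)
qed (rule is_functor_Cat_op_Grp)

end
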